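(* Let $n \ge 2$, let $J \subseteq \{1,\dots,n-1\}$ be nonempty, and set $S=\bigcup_{k\in J} S_k$ and $$M=\max_{k\in J}\,\dim(S_k)=\max_{k\in J}\, k(n-k+1).$$ Then, except for a set of measure zero, no element of $\text{Möb}(n)$ can be written as a product $\alpha_1\cdots\alpha_m$ with $\alpha_i\in S$ for all $i$ and $m<\frac{n(n+1)}{2M}$. That is, the set of elements of $\text{Möb}(n)$ which can be written in this form has measure zero.
   Context: $\text{Möb}(n)$ is the full isometry group of hyperbolic $n$-space $\mathbb{H}^n$, a Lie group of dimension $\frac{n(n+1)}{2}$; "measure zero" is meant in the sense of smooth manifolds (equivalently, with respect to Haar measure). An involution is an isometry of order two; its fixed point set is a totally geodesic subspace. $S_k\subset \text{Möb}(n)$ is the set of all involutions whose fixed point set has codimension $k$; it is a submanifold of $\text{Möb}(n)$ of dimension $k(n-k+1)$. *)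

theory Defs
  imports "HOL-Analysis.Analysis"
begin

text \<open>
  Hyperbolic \<open>n\<close>-space, \<open>n = CARD('n)\<close>, is the upper sheet of the hyperboloid in Minkowski space
  \<open>'n mink\<close> (time coordinate last), with the metric \<open>cosh d(p,q) = - \<langle>p,q\<rangle>\<close>.
\<close>

type_synonym 'n mink = "(real ^ 'n) \<times> real"

definition lor :: "('n::finite) mink \<Rightarrow> 'n mink \<Rightarrow> real" where
  "lor p q = fst p \<bullet> fst q - snd p * snd q"

definition hyp :: "('n::finite) mink set" where
  "hyp = {p. lor p p = - 1 \<and> snd p > 0}"

definition hdist :: "('n::finite) mink \<Rightarrow> 'n mink \<Rightarrow> real" where
  "hdist p q = arcosh (- lor p q)"

text \<open>
  Isometries are functions on \<open>hyp\<close>, represented extensionally (\<open>undefined\<close> outside \<open>hyp\<close>), so that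
  equality of elements of \<open>Mob\<close> is equality of isometries.
\<close>

type_synonym 'n hypfun = "'n mink \<Rightarrow> 'n mink"

definition Mob :: "('n::finite) hypfun set" where
  "Mob = {g. g \<in> extensional hyp \<and> bij_betw g hyp hyp
             \<and> (\<forall>p\<in>hyp. \<forall>q\<in>hyp. hdist (g p) (g q) = hdist p q)}"

definition mob_one :: "('n::finite) hypfun" where
  "mob_one = (\<lambda>p\<in>hyp. p)"

definition mob_prod :: "('n::finite) hypfun list \<Rightarrow> 'n hypfun" where
  "mob_prod \<alpha>s = foldr (compose hyp) \<alpha>s mob_one"

definition fixed_points :: "('n::finite) hypfun \<Rightarrow> 'n mink set" where
  "fixed_points g = {p \<in> hyp. g p = p}"

text \<open>
  The totally geodesic subspaces of dimension \<open>m\<close> are the nonempty intersections of \<open>hyp\<close> with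
  linear subspaces of dimension \<open>m + 1\<close>.
\<close>

definition totally_geodesic :: "nat \<Rightarrow> ('n::finite) mink set \<Rightarrow> bool" where
  "totally_geodesic m F \<longleftrightarrow> F \<noteq> {} \<and> (\<exists>W. subspace W \<and> dim W = m + 1 \<and> F = hyp \<inter> W)"

definition involutions :: "nat \<Rightarrow> ('n::finite) hypfun set" where
  "involutions k = {g \<in> Mob. g \<noteq> mob_one \<and> compose hyp g g = mob_one
                       \<and> (\<exists>m. m + k = CARD('n) \<and> totally_geodesic m (fixed_points g))}"

text \<open>\<open>C\<^sup>k\<close> and \<open>C\<^sup>\<infinity>\<close> maps on an open set, via iterated directional derivatives.\<close>

primrec Ck_on :: "nat \<Rightarrow> 'd set \<Rightarrow> ('d::euclidean_space \<Rightarrow> 'b::real_normed_vector) \<Rightarrow> bool" where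
  "Ck_on 0 U f \<longleftrightarrow> continuous_on U f"
| "Ck_on (Suc k) U f \<longleftrightarrow> (\<forall>x\<in>U. f differentiable (at x))
                          \<and> (\<forall>v. Ck_on k U (\<lambda>x. frechet_derivative f (at x) v))"

definition smooth_on :: "'d set \<Rightarrow> ('d::euclidean_space \<Rightarrow> 'b::real_normed_vector) \<Rightarrow> bool" where
  "smooth_on U f \<longleftrightarrow> (\<forall>k. Ck_on k U f)"

text \<open>
  Charts of an embedded submanifold \<open>M\<close> with model space \<open>'d\<close>, given by their inverses: a smooth
  immersion \<open>\<phi>\<close> of an open \<open>U\<close> that is a homeomorphism onto a relatively open part of \<open>M\<close>.
  \<open>A\<close> has measure zero in \<open>M\<close> if it is a Lebesgue null set in every chart.
\<close>

definition smooth_chart ::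
    "'d set \<Rightarrow> ('d::euclidean_space \<Rightarrow> 'b::real_normed_vector) \<Rightarrow> 'b set \<Rightarrow> bool" where
  "smooth_chart U \<phi> M \<longleftrightarrow> open U \<and> smooth_on U \<phi>
     \<and> (\<forall>u\<in>U. inj (frechet_derivative \<phi> (at u)))
     \<and> openin (top_of_set M) (\<phi> ` U)
     \<and> (\<exists>\<psi>. homeomorphism U (\<phi> ` U) \<phi> \<psi>)"

definition measure_zero_in ::
    "'d::euclidean_space itself \<Rightarrow> 'b::real_normed_vector set \<Rightarrow> 'b set \<Rightarrow> bool" where
  "measure_zero_in _ M A \<longleftrightarrow> A \<subseteq> M
     \<and> (\<forall>U (\<phi> :: 'd \<Rightarrow> 'b). smooth_chart U \<phi> M \<longrightarrow> negligible {u \<in> U. \<phi> u \<in> A})"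

text \<open>
  The Lie group structure of \<open>Mob\<close> is that of the linear group \<open>O\<^sup>+(n,1)\<close>: every isometry is the
  restriction of exactly one linear endomorphism of Minkowski space (\<open>Mob_linear_extension\<close> below).
\<close>

definition linear_rep ::
    "('n::finite) hypfun set \<Rightarrow> ('n mink \<Rightarrow>\<^sub>L 'n mink) set" where
  "linear_rep A = {L. restrict (blinfun_apply L) hyp \<in> A}"

definition Mob_measure_zero :: "'d::euclidean_space itself \<Rightarrow> ('n::finite) hypfun set \<Rightarrow> bool" where
  "Mob_measure_zero d A \<longleftrightarrow> A \<subseteq> Mob \<and> measure_zero_in d (linear_rep Mob) (linear_rep A)"

lemma lor_hyp_ge_1:
  assumes "p \<in> hyp" "q \<in> hyp"
  shows "- lor p q \<ge> 1"
proof -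
  obtain x s where p: "p = (x, s)" by (cases p)
  obtain y t where q: "q = (y, t)" by (cases q)
  have s: "s > 0" "s\<^sup>2 = 1 + (norm x)\<^sup>2" and t: "t > 0" "t\<^sup>2 = 1 + (norm y)\<^sup>2"
    using assms by (auto simp: p q hyp_def lor_def power2_norm_eq_inner power2_eq_square[of s] power2_eq_square[of t])
  have "(1 + norm x * norm y)\<^sup>2 \<le> (1 + (norm x)\<^sup>2) * (1 + (norm y)\<^sup>2)"
    using sum_squares_ge_zero[of "norm x - norm y" 0]
    by (simp add: power2_eq_square algebra_simps)
  also have "\<dots> = (s * t)\<^sup>2"
    by (simp add: power_mult_distrib s t)
  finally have "1 + norm x * norm y \<le> s * t"
    by (rule power2_le_imp_le) (use s t in simp)
  moreover have "x \<bullet> y \<le> norm x * norm y"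
    by (rule norm_cauchy_schwarz)
  ultimately show ?thesis
    by (simp add: p q lor_def)
qed

lemma Mob_lor:
  assumes "g \<in> Mob" "p \<in> hyp" "q \<in> hyp"
  shows "lor (g p) (g q) = lor p q"
proof -
  have "g p \<in> hyp" "g q \<in> hyp"
    using assms by (auto simp: Mob_def bij_betw_def)
  then have "- lor (g p) (g q) = cosh (hdist (g p) (g q))" "- lor p q = cosh (hdist p q)"
    using assms(2,3) unfolding hdist_def by (metis cosh_arcosh_real lor_hyp_ge_1)+
  then show ?thesis
    using assms by (simp add: Mob_def)
qed

lemma bilinear_lor: "bilinear lor"
  by (auto simp: bilinear_def lor_def algebra_simps intro!: linearI)

lemma lor_nondegenerate:
  assumes "\<And>v. lor w v = 0"
  shows "w = 0"
proof -
  have "lor w (fst w, - snd w) = fst w \<bullet> fst w + snd w * snd w"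
    by (simp add: lor_def)
  then have "fst w \<bullet> fst w + snd w * snd w = 0"
    using assms by simp
  then show ?thesis
    by (metis inner_ge_zero inner_eq_zero_iff add_nonneg_eq_0_iff zero_le_square mult_eq_0_iff
        prod_eq_iff fst_zero snd_zero)
qed

lemma span_hyp: "span (hyp :: ('n::finite) mink set) = UNIV"
proof -
  have 1: "(0, 1) \<in> span (hyp :: 'n mink set)"
    by (rule span_base) (simp add: hyp_def lor_def)
  have "(x, s) \<in> span hyp" for x :: "real ^ 'n" and s
  proof -
    have "0 < 1 + x \<bullet> x"
      by (smt (verit) inner_ge_zero)
    then have "(x, sqrt (1 + x \<bullet> x)) \<in> span hyp"
      by (intro span_base) (simp add: hyp_def lor_def)
    moreover have "(x, s) = (x, sqrt (1 + x \<bullet> x)) + (s - sqrt (1 + x \<bullet> x)) *\<^sub>R (0, 1)"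
      by simp
    ultimately show ?thesis
      by (metis 1 span_add span_scale)
  qed
  then show ?thesis by auto
qed

lemma Mob_linear_extension:
  fixes g :: "('n::finite) hypfun"
  assumes g: "g \<in> Mob"
  shows "\<exists>!L. restrict (blinfun_apply L) hyp = g"
proof (rule ex_ex1I)
  obtain B :: "'n mink set" where B: "B \<subseteq> hyp" "independent B" "hyp \<subseteq> span B"
    using maximal_independent_subset by blast
  have sB: "span B = UNIV"
    using B(3) span_hyp by (metis span_mono span_span top.extremum_uniqueI)
  obtain L where L: "linear L" "\<And>b. b \<in> B \<Longrightarrow> L b = g b"
    using linear_independent_extend[OF B(2), of g] by blast
  have bL: "bilinear (\<lambda>x y. lor (L x) (L y))"
    unfolding bilinear_def
  proof (intro conjI allI)
    fix x
    show "linear (\<lambda>y. lor (L x) (L y))"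
      using linear_compose[OF L(1), of "lor (L x)"] bilinear_lor
      unfolding bilinear_def o_def by blast
    show "linear (\<lambda>y. lor (L y) (L x))"
      using linear_compose[OF L(1), of "\<lambda>y. lor y (L x)"] bilinear_lor
      unfolding bilinear_def o_def by blast
  qed
  have LL: "lor (L x) (L y) = lor x y" for x y
    by (rule bilinear_eq[OF bL bilinear_lor, of UNIV B UNIV B])
      (use B(1) sB L(2) Mob_lor[OF g] in \<open>auto simp: subset_iff\<close>)
  have "inj L"
    unfolding linear_injective_0[OF L(1)]
  proof (intro allI impI)
    fix v assume "L v = 0"
    then have "lor v w = 0" for w
      using LL[of v w] by (simp add: lor_def)
    then show "v = 0" by (rule lor_nondegenerate)
  qed
  then have surj: "surj L"
    by (rule linear_inj_imp_surj[OF L(1)])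
  have "L p = g p" if p: "p \<in> hyp" for p
  proof -
    have eq: "lor (g p) (L y) = lor p y" for y
    proof (rule linear_eq_on_span[of "\<lambda>y. lor (g p) (L y)" "lor p" B y])
      show "linear (\<lambda>y. lor (g p) (L y))"
        using bilinear_lor linear_compose[OF L(1), of "lor (g p)"]
        unfolding bilinear_def o_def by blast
      show "linear (lor p)"
        using bilinear_lor unfolding bilinear_def by blast
      show "y \<in> span B" by (simp add: sB)
      show "lor (g p) (L x) = lor p x" if "x \<in> B" for x
        using that B(1) L(2)[OF that] Mob_lor[OF g p, of x] by auto
    qed
    have "lor (g p - L p) v = 0" for v
    proof -
      obtain y where "v = L y" using surj by blast
      then show ?thesis
        using eq[of y] LL[of p y] by (simp add: lor_def algebra_simps)
    qed
    then show ?thesis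
      using lor_nondegenerate[of "g p - L p"] by simp
  qed
  moreover have "g \<in> extensional hyp"
    using g by (simp add: Mob_def)
  ultimately have "restrict (blinfun_apply (Blinfun L)) hyp = g"
    using L(1) by (auto simp: bounded_linear_Blinfun_apply linear_conv_bounded_linear
        fun_eq_iff extensional_def)
  then show "\<exists>L. restrict (blinfun_apply L) hyp = g" ..
next
  fix L L' :: "'n mink \<Rightarrow>\<^sub>L 'n mink"
  assume "restrict (blinfun_apply L) hyp = g" "restrict (blinfun_apply L') hyp = g"
  then have eq: "L x = L' x" if "x \<in> hyp" for x
    using that by (metis restrict_apply')
  have "L x = L' x" for x
    by (rule linear_eq_on_span[of "blinfun_apply L" "blinfun_apply L'" hyp])
      (auto simp: span_hyp blinfun.bounded_linear_right bounded_linear.linear intro: eq)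
  then show "L = L'"
    by (rule blinfun_eqI)
qed

end

theory Submission
  imports Defs
begin

text \<open>
  The theorem is a dimension count. The involutions of type \<open>k\<close> form a family with
  \<open>k (n - k + 1)\<close> parameters, so the products of \<open>m\<close> elements of \<open>S\<close> form a family with at most
  \<open>m M\<close> parameters. If \<open>m < n (n + 1) / (2 M)\<close>, then \<open>m M\<close> is less than the dimension
  \<open>n (n + 1) / 2\<close> of the group, and a family with too few parameters is a null set.

  ``At most \<open>d\<close> parameters'' is made precise by box counting: a bounded set has box dimension
  at most \<open>d\<close> if it can be covered by \<open>O(e\<^sup>-\<^sup>d)\<close> sets of diameter \<open>e\<close>. This replaces parametrising
  maps out of Euclidean spaces, whose dimension is part of their type and so cannot be the
  variable number \<open>m M\<close>. It also makes products easy: composition is Lipschitz on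
  bounded sets, hence box dimensions add (\<open>box_dim_le_compose\<close>). Unbounded families are handled by
  countable unions (\<open>sigma_box_dim_le\<close>).

  Three facts carry the proof. A set of box dimension below \<open>d\<close> is null in a \<open>d\<close>-dimensional
  Euclidean space, because the total volume of a cover by \<open>e\<close>-balls tends to \<open>0\<close>
  (\<open>negligible_box_dim_le\<close>). A \<open>C\<^sup>1\<close> immersion expands distances locally, up to a positive factor, so
  small sets have small preimages under a chart (\<open>negligible_immersion_vimage\<close>). The involutions
  of type \<open>k\<close> have box dimension at most \<open>k (n - k + 1)\<close> (\<open>sigma_box_dim_involutions\<close>).

  For the last fact, extend an involution to a linear map \<open>L\<close> of Minkowski space. It is a
  Lorentz reflection: \<open>L\<close> is the identity on the span of its fixed points and \<open>-1\<close> on a complement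
  \<open>N\<close> of dimension \<open>k\<close>. Over a suitable set \<open>I\<close> of \<open>k\<close> coordinates \<open>N\<close> is a graph, described by a
  matrix with \<open>k (n + 1 - k)\<close> entries. That \<open>L\<close> is a Lipschitz function of this matrix, as long as
  the norms stay bounded, follows without inverting any matrix from
  \[ 2 (L - L') = (1 + L) (1 - L') - (1 - L) (1 + L'). \]
  The first term is small because \<open>1 - L'\<close> maps into the \<open>-1\<close>-space \<open>N'\<close> of \<open>L'\<close>, which is close to
  \<open>N\<close>, while \<open>1 + L\<close> vanishes on \<open>N\<close>; the second is the Lorentz adjoint of the same expression with
  \<open>L\<close> and \<open>L'\<close> exchanged (\<open>lor_involution_distance\<close>).
\<close>

section \<open>Box dimension\<close>

definition fine_cover :: "real \<Rightarrow> 'a::metric_space set \<Rightarrow> 'a set set \<Rightarrow> bool" where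
  "fine_cover e A F \<longleftrightarrow> finite F \<and> A \<subseteq> \<Union>F \<and> (\<forall>X\<in>F. \<forall>x\<in>X. \<forall>y\<in>X. dist x y \<le> e)"

text \<open>
  Upper box-counting dimension at most \<open>d\<close>, with a uniform constant. Scales above \<open>1\<close> are left out
  so that the condition becomes weaker as \<open>d\<close> grows.
\<close>

definition box_dim_le :: "nat \<Rightarrow> 'a::metric_space set \<Rightarrow> bool" where
  "box_dim_le d A \<longleftrightarrow> bounded A
     \<and> (\<exists>C. \<forall>e. 0 < e \<and> e \<le> 1 \<longrightarrow> (\<exists>F. fine_cover e A F \<and> real (card F) \<le> C * (1 / e) ^ d))"

definition sigma_box_dim_le :: "nat \<Rightarrow> 'a::metric_space set \<Rightarrow> bool" where
  "sigma_box_dim_le d A \<longleftrightarrow> (\<exists>\<A>. countable \<A> \<and> A \<subseteq> \<Union>\<A> \<and> (\<forall>X\<in>\<A>. box_dim_le d X))"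

text \<open>
  Diameters may be controlled up to a constant factor only: rescaling \<open>e\<close> changes just the
  constant \<open>C\<close>. All constructions below produce such a factor.
\<close>

lemma box_dim_leI:
  assumes "bounded A"
    and cov: "\<And>e. 0 < e \<Longrightarrow> e \<le> 1 \<Longrightarrow>
      \<exists>F. fine_cover (K * e) A F \<and> real (card F) \<le> C * (1 / e) ^ d"
  shows "box_dim_le d A"
proof -
  define K' where "K' = max K 1"
  have K': "K' \<ge> 1" "K \<le> K'"
    by (auto simp: K'_def)
  have "\<exists>F. fine_cover e A F \<and> real (card F) \<le> (C * K' ^ d) * (1 / e) ^ d"
    if e: "0 < e" "e \<le> 1" for e
  proof -
    obtain F where F: "fine_cover (K * (e / K')) A F" "real (card F) \<le> C * (1 / (e / K')) ^ d"
      using cov[of "e / K'"] e K' by (auto simp: field_simps)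
    have "K * (e / K') \<le> e"
      using K' e by (simp add: field_simps)
    then have "fine_cover e A F"
      using F(1) unfolding fine_cover_def by (meson order_trans)
    moreover have "C * (1 / (e / K')) ^ d = (C * K' ^ d) * (1 / e) ^ d"
      by (simp add: power_divide)
    ultimately show ?thesis
      using F(2) by auto
  qed
  then show ?thesis
    using assms(1) unfolding box_dim_le_def by blast
qed

lemma box_dim_le_mono:
  assumes "box_dim_le d A" "d \<le> d'"
  shows "box_dim_le d' A"
proof -
  obtain C where C: "\<And>e. 0 < e \<Longrightarrow> e \<le> 1 \<Longrightarrow>
      \<exists>F. fine_cover e A F \<and> real (card F) \<le> C * (1 / e) ^ d"
    using assms(1) unfolding box_dim_le_def by blast
  have "C * (1 / e) ^ d \<le> \<bar>C\<bar> * (1 / e) ^ d'" if "0 < e" "e \<le> 1" for e :: real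
    using that assms(2) by (intro mult_mono power_increasing) auto
  then show ?thesis
    using C assms(1) unfolding box_dim_le_def by (meson order_trans)
qed

text \<open>
  How a parameter count gives a box dimension: if the points of \<open>A\<close> depend in a Lipschitz way on
  \<open>card Q\<close> bounded real coordinates, then rounding the coordinates to multiples of \<open>e\<close> sorts \<open>A\<close>
  into \<open>O((1 / e) ^ card Q)\<close> cells of diameter \<open>O(e)\<close>.
\<close>

lemma box_dim_le_coordinates:
  fixes f :: "'a::metric_space \<Rightarrow> 'q \<Rightarrow> real"
  assumes Q: "finite Q" and A: "bounded A"
    and R: "\<And>x q. x \<in> A \<Longrightarrow> q \<in> Q \<Longrightarrow> \<bar>f x q\<bar> \<le> R"
    and K: "\<And>x y t. x \<in> A \<Longrightarrow> y \<in> A \<Longrightarrow> 0 \<le> t \<Longrightarrow> (\<And>q. q \<in> Q \<Longrightarrow> \<bar>f x q - f y q\<bar> \<le> t)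
      \<Longrightarrow> dist x y \<le> K * t"
  shows "box_dim_le (card Q) A"
proof (rule box_dim_leI[OF A])
  fix e :: real
  assume e: "0 < e" "e \<le> 1"
  define cell where "cell x = (\<lambda>q\<in>Q. \<lfloor>f x q / e\<rfloor>)" for x
  define N where "N = \<lceil>\<bar>R\<bar> / e\<rceil>"
  define G where "G = (Q \<rightarrow>\<^sub>E {- N .. N})"
  define F where "F = (\<lambda>c. {x \<in> A. cell x = c}) ` G"
  have "0 \<le> \<bar>R\<bar> / e"
    using e by simp
  then have N0: "N \<ge> 0"
    unfolding N_def by linarith
  have finG: "finite G"
    unfolding G_def by (intro finite_PiE Q) simp
  have cell: "cell x \<in> G" if x: "x \<in> A" for x
  proof -
    have "- N \<le> \<lfloor>f x q / e\<rfloor> \<and> \<lfloor>f x q / e\<rfloor> \<le> N" if "q \<in> Q" for q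
    proof -
      have "\<bar>f x q / e\<bar> \<le> \<bar>R\<bar> / e"
        using R[OF x that] e by (simp add: divide_right_mono)
      also have "\<dots> \<le> of_int N"
        by (simp add: N_def)
      finally have b: "- of_int N \<le> f x q / e" "f x q / e \<le> of_int N"
        by linarith+
      then show ?thesis
        by (simp add: le_floor_iff floor_le_iff)
    qed
    then show ?thesis
      by (auto simp: G_def cell_def)
  qed
  have "fine_cover (K * e) A F"
    unfolding fine_cover_def
  proof (intro conjI ballI)
    show "finite F"
      by (simp add: F_def finG)
    show "A \<subseteq> \<Union>F"
      using cell by (auto simp: F_def)
    fix X x y
    assume "X \<in> F" "x \<in> X" "y \<in> X"
    then have xy: "x \<in> A" "y \<in> A" "cell x = cell y"
      by (auto simp: F_def)
    have "\<bar>f x q - f y q\<bar> \<le> e" if "q \<in> Q" for q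
    proof -
      have "\<lfloor>f x q / e\<rfloor> = \<lfloor>f y q / e\<rfloor>"
        using fun_cong[OF xy(3), of q] that by (simp add: cell_def)
      then have "\<bar>f x q / e - f y q / e\<bar> \<le> 1"
        by linarith
      then show ?thesis
        using e by (simp add: field_simps abs_le_iff)
    qed
    then show "dist x y \<le> K * e"
      using K[OF xy(1,2)] e by simp
  qed
  moreover have "real (card F) \<le> (2 * \<bar>R\<bar> + 3) ^ card Q * (1 / e) ^ card Q"
  proof -
    have "real (card F) \<le> real (card G)"
      unfolding F_def using card_image_le[OF finG] by simp
    also have "card G = (card {- N .. N}) ^ card Q"
      by (simp add: G_def card_PiE[OF Q])
    also have "real ((card {- N .. N}) ^ card Q) = (2 * of_int N + 1) ^ card Q"
      using N0 by simp
    also have "\<dots> \<le> ((2 * \<bar>R\<bar> + 3) / e) ^ card Q"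
    proof (rule power_mono)
      have "of_int N \<le> \<bar>R\<bar> / e + 1"
        by (simp add: N_def)
      moreover have "1 \<le> 1 / e"
        using e by simp
      ultimately show "2 * of_int N + 1 \<le> (2 * \<bar>R\<bar> + 3) / e"
        by (simp add: add_divide_distrib)
    qed (use N0 in simp)
    also have "\<dots> = (2 * \<bar>R\<bar> + 3) ^ card Q * (1 / e) ^ card Q"
      by (simp add: power_divide)
    finally show ?thesis .
  qed
  ultimately show "\<exists>F. fine_cover (K * e) A F
      \<and> real (card F) \<le> (2 * \<bar>R\<bar> + 3) ^ card Q * (1 / e) ^ card Q"
    by blast
qed

text \<open>
  Pulling back a cover along \<open>\<phi>\<close> enlarges diameters by the factor \<open>1 / B\<close> at most.
\<close>

lemma box_dim_le_expanding_vimage: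
  fixes \<phi> :: "'a::metric_space \<Rightarrow> 'b::metric_space"
  assumes "box_dim_le d A" "bounded V" and B: "B > 0"
    and expand: "\<And>u v. u \<in> V \<Longrightarrow> v \<in> V \<Longrightarrow> B * dist u v \<le> dist (\<phi> u) (\<phi> v)"
  shows "box_dim_le d {u \<in> V. \<phi> u \<in> A}"
proof -
  obtain C where C: "\<And>e. 0 < e \<Longrightarrow> e \<le> 1 \<Longrightarrow>
      \<exists>F. fine_cover e A F \<and> real (card F) \<le> C * (1 / e) ^ d"
    using assms(1) unfolding box_dim_le_def by blast
  show ?thesis
  proof (rule box_dim_leI[where K = "1 / B" and C = C])
    show "bounded {u \<in> V. \<phi> u \<in> A}"
      using assms(2) by (rule bounded_subset) auto
    fix e :: real
    assume e: "0 < e" "e \<le> 1"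
    then obtain F where F: "fine_cover e A F" "real (card F) \<le> C * (1 / e) ^ d"
      using C by blast
    define G where "G = (\<lambda>X. {u \<in> V. \<phi> u \<in> X}) ` F"
    have "fine_cover (1 / B * e) {u \<in> V. \<phi> u \<in> A} G"
      unfolding fine_cover_def
    proof (intro conjI ballI)
      show "finite G" "{u \<in> V. \<phi> u \<in> A} \<subseteq> \<Union>G"
        using F(1) by (auto simp: G_def fine_cover_def)
      fix X u v
      assume "X \<in> G" "u \<in> X" "v \<in> X"
      then obtain Y where "Y \<in> F" "\<phi> u \<in> Y" "\<phi> v \<in> Y" "u \<in> V" "v \<in> V"
        by (auto simp: G_def)
      then have "B * dist u v \<le> e"
        using F(1) expand[of u v] unfolding fine_cover_def by (meson order_trans)
      then show "dist u v \<le> 1 / B * e"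
        using B by (simp add: field_simps)
    qed
    moreover have "card G \<le> card F"
      using F(1) by (simp add: G_def fine_cover_def card_image_le)
    ultimately show "\<exists>F. fine_cover (1 / B * e) {u \<in> V. \<phi> u \<in> A} F
        \<and> real (card F) \<le> C * (1 / e) ^ d"
      using F(2) by (meson of_nat_mono order_trans)
  qed
qed

text \<open>
  A cover of \<open>A\<close> and a cover of \<open>B\<close> give a cover by products. Its pieces are small because
  \<open>x y - x' y' = x (y - y') + (x - x') y'\<close> and all norms are bounded; the numbers of pieces multiply,
  so the exponents add.
\<close>

lemma box_dim_le_compose:
  fixes A :: "('b::real_normed_vector \<Rightarrow>\<^sub>L 'c::real_normed_vector) set"
    and B :: "('a::real_normed_vector \<Rightarrow>\<^sub>L 'b) set"
  assumes "box_dim_le a A" "box_dim_le b B"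
  shows "box_dim_le (a + b) {x o\<^sub>L y |x y. x \<in> A \<and> y \<in> B}"
proof -
  obtain R where R: "R > 0" "\<And>x. x \<in> A \<Longrightarrow> norm x \<le> R"
    using assms(1) by (auto simp: box_dim_le_def bounded_pos)
  obtain R' where R': "R' > 0" "\<And>y. y \<in> B \<Longrightarrow> norm y \<le> R'"
    using assms(2) by (auto simp: box_dim_le_def bounded_pos)
  obtain C where C: "\<And>e. 0 < e \<Longrightarrow> e \<le> 1 \<Longrightarrow>
      \<exists>F. fine_cover e A F \<and> real (card F) \<le> C * (1 / e) ^ a"
    using assms(1) unfolding box_dim_le_def by blast
  obtain C' where C': "\<And>e. 0 < e \<Longrightarrow> e \<le> 1 \<Longrightarrow>
      \<exists>F. fine_cover e B F \<and> real (card F) \<le> C' * (1 / e) ^ b"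
    using assms(2) unfolding box_dim_le_def by blast
  show ?thesis
  proof (rule box_dim_leI[where K = "R + R'" and C = "C * C'"])
    show "bounded {x o\<^sub>L y |x y. x \<in> A \<and> y \<in> B}"
      unfolding bounded_iff
    proof (intro exI ballI)
      fix z assume "z \<in> {x o\<^sub>L y |x y. x \<in> A \<and> y \<in> B}"
      then obtain x y where z: "z = x o\<^sub>L y" "x \<in> A" "y \<in> B"
        by blast
      have "norm z \<le> norm x * norm y"
        unfolding z by (rule norm_blinfun_compose)
      also have "\<dots> \<le> R * R'"
        using R(1) R(2)[OF z(2)] R'(2)[OF z(3)] by (intro mult_mono) auto
      finally show "norm z \<le> R * R'" .
    qed
    fix e :: real
    assume e: "0 < e" "e \<le> 1"
    obtain F where F: "fine_cover e A F" "real (card F) \<le> C * (1 / e) ^ a"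
      using C e by blast
    obtain G where G: "fine_cover e B G" "real (card G) \<le> C' * (1 / e) ^ b"
      using C' e by blast
    define H where "H = (\<lambda>(X, Y). {x o\<^sub>L y |x y. x \<in> X \<inter> A \<and> y \<in> Y \<inter> B}) ` (F \<times> G)"
    have AF: "A \<subseteq> \<Union>F" and BG: "B \<subseteq> \<Union>G"
      using F(1) G(1) by (simp_all add: fine_cover_def)
    have "fine_cover ((R + R') * e) {x o\<^sub>L y |x y. x \<in> A \<and> y \<in> B} H"
      unfolding fine_cover_def
    proof (intro conjI ballI)
      show "finite H"
        using F(1) G(1) by (auto simp: H_def fine_cover_def)
      show "{x o\<^sub>L y |x y. x \<in> A \<and> y \<in> B} \<subseteq> \<Union>H"
      proof
        fix z assume "z \<in> {x o\<^sub>L y |x y. x \<in> A \<and> y \<in> B}"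
        then obtain x y where z: "z = x o\<^sub>L y" "x \<in> A" "y \<in> B"
          by blast
        obtain X Y where XY: "X \<in> F" "x \<in> X" "Y \<in> G" "y \<in> Y"
          using z(2,3) AF BG by blast
        have "{x o\<^sub>L y |x y. x \<in> X \<inter> A \<and> y \<in> Y \<inter> B} \<in> H"
          unfolding H_def using XY(1,3) by (intro image_eqI[of _ _ "(X, Y)"]) auto
        then show "z \<in> \<Union>H"
          using z XY(2,4) by blast
      qed
      fix Z z z'
      assume "Z \<in> H" "z \<in> Z" "z' \<in> Z"
      obtain X Y where XY: "X \<in> F" "Y \<in> G"
        and Z: "Z = {x o\<^sub>L y |x y. x \<in> X \<inter> A \<and> y \<in> Y \<inter> B}"
        using \<open>Z \<in> H\<close> unfolding H_def by (elim imageE) (auto simp only: mem_Sigma_iff split: prod.splits)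
      obtain x y where xy: "x \<in> X" "x \<in> A" "y \<in> Y" "y \<in> B" and z: "z = x o\<^sub>L y"
        using \<open>z \<in> Z\<close> unfolding Z by blast
      obtain x' y' where xy': "x' \<in> X" "x' \<in> A" "y' \<in> Y" "y' \<in> B" and z': "z' = x' o\<^sub>L y'"
        using \<open>z' \<in> Z\<close> unfolding Z by blast
      have d: "norm (x - x') \<le> e"
        using XY(1) xy(1) xy'(1) F(1) unfolding fine_cover_def dist_norm by blast
      have d': "norm (y - y') \<le> e"
        using XY(2) xy(3) xy'(3) G(1) unfolding fine_cover_def dist_norm by blast
      have "z - z' = (x o\<^sub>L (y - y')) + ((x - x') o\<^sub>L y')"
        by (rule blinfun_eqI)
          (simp add: z z' blinfun.diff_left blinfun.diff_right blinfun.add_left)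
      then have "dist z z' \<le> norm (x o\<^sub>L (y - y')) + norm ((x - x') o\<^sub>L y')"
        by (simp add: dist_norm norm_triangle_ineq)
      also have "\<dots> \<le> norm x * norm (y - y') + norm (x - x') * norm y'"
        by (intro add_mono norm_blinfun_compose)
      also have "\<dots> \<le> R * e + e * R'"
        using d d' R(1) R'(1) R(2)[OF xy(2)] R'(2)[OF xy'(4)] e by (intro add_mono mult_mono) auto
      finally show "dist z z' \<le> (R + R') * e"
        by (simp add: algebra_simps)
    qed
    moreover have "real (card H) \<le> C * C' * (1 / e) ^ (a + b)"
    proof -
      have "card H \<le> card (F \<times> G)"
        unfolding H_def using F(1) G(1) by (intro card_image_le) (auto simp: fine_cover_def)
      then have "real (card H) \<le> real (card F) * real (card G)"
        by (metis card_cartesian_product of_nat_mono of_nat_mult)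
      also have "\<dots> \<le> (C * (1 / e) ^ a) * (C' * (1 / e) ^ b)"
        by (rule mult_mono[OF F(2) G(2) order_trans[OF of_nat_0_le_iff F(2)] of_nat_0_le_iff])
      finally show ?thesis
        by (simp add: power_add mult_ac)
    qed
    ultimately show "\<exists>F. fine_cover ((R + R') * e) {x o\<^sub>L y |x y. x \<in> A \<and> y \<in> B} F
        \<and> real (card F) \<le> C * C' * (1 / e) ^ (a + b)"
      by (intro exI conjI)
  qed
qed

text \<open>
  \<open>C (1 / e) ^ d\<close> balls of radius \<open>e\<close> have total volume \<open>O(e ^ (DIM('d) - d))\<close>, which tends to \<open>0\<close>
  with \<open>e\<close>.
\<close>

lemma negligible_box_dim_le:
  fixes A :: "'d::euclidean_space set"
  assumes "box_dim_le d A" and d: "d < DIM('d)"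
  shows "negligible A"
  unfolding negligible_outer_le
proof (intro allI impI)
  fix \<delta> :: real
  assume \<delta>: "\<delta> > 0"
  obtain C where C: "\<And>e. 0 < e \<Longrightarrow> e \<le> 1 \<Longrightarrow>
      \<exists>F. fine_cover e A F \<and> real (card F) \<le> C * (1 / e) ^ d"
    using assms(1) unfolding box_dim_le_def by blast
  define V where "V = unit_ball_vol (real DIM('d))"
  have V: "V > 0"
    by (simp add: V_def)
  \<comment> \<open>chosen so that the total volume, at most \<open>\<bar>C\<bar> V e\<close>, is at most \<open>\<delta>\<close>\<close>
  define e where "e = min 1 (\<delta> / (\<bar>C\<bar> * V + 1))"
  have pos: "\<bar>C\<bar> * V + 1 > 0"
    using V by (simp add: add_nonneg_pos)
  have e: "0 < e" "e \<le> 1"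
    using \<delta> pos by (auto simp: e_def)
  obtain F where F: "fine_cover e A F" "real (card F) \<le> C * (1 / e) ^ d"
    using C e by blast
  have finF: "finite F"
    using F(1) by (simp add: fine_cover_def)
  define T where "T = (\<Union>X\<in>F. cball (SOME x. x \<in> X) e)"
  show "\<exists>T. A \<subseteq> T \<and> T \<in> lmeasurable \<and> measure lebesgue T \<le> \<delta>"
  proof (intro exI conjI)
    show "A \<subseteq> T"
    proof
      fix x assume "x \<in> A"
      then obtain X where X: "X \<in> F" "x \<in> X"
        using F(1) by (auto simp: fine_cover_def)
      then have "(SOME x. x \<in> X) \<in> X"
        by (metis someI)
      then have "dist (SOME x. x \<in> X) x \<le> e"
        using F(1) X by (auto simp: fine_cover_def)
      then show "x \<in> T"
        using X by (auto simp: T_def)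
    qed
    show "T \<in> lmeasurable"
      unfolding T_def using finF by (intro fmeasurable.finite_UN) auto
    have "measure lebesgue T \<le> (\<Sum>X\<in>F. measure lebesgue (cball (SOME x. x \<in> X) e))"
      unfolding T_def using finF by (intro measure_UNION_le) auto
    also have "\<dots> = real (card F) * (V * e ^ DIM('d))"
      using e by (simp add: content_cball V_def)
    also have "\<dots> \<le> (\<bar>C\<bar> * (1 / e) ^ d) * (V * e ^ DIM('d))"
      using F(2) V e by (intro mult_right_mono order_trans[OF F(2)]) auto
    also have "\<dots> = \<bar>C\<bar> * V * e ^ (DIM('d) - d)"
      using e d by (simp add: power_diff power_divide)
    also have "\<dots> \<le> \<bar>C\<bar> * V * e ^ 1"
      using e d V by (intro mult_left_mono power_decreasing) auto
    also have "\<dots> \<le> (\<bar>C\<bar> * V + 1) * e"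
      using e by (simp add: algebra_simps)
    also have "\<dots> \<le> (\<bar>C\<bar> * V + 1) * (\<delta> / (\<bar>C\<bar> * V + 1))"
      using pos by (intro mult_left_mono) (auto simp: e_def)
    also have "\<dots> = \<delta>"
      using pos by simp
    finally show "measure lebesgue T \<le> \<delta>" .
  qed
qed

lemma sigma_box_dim_le_subset:
  "sigma_box_dim_le d B \<Longrightarrow> A \<subseteq> B \<Longrightarrow> sigma_box_dim_le d A"
  unfolding sigma_box_dim_le_def by (meson order_trans)

lemma sigma_box_dim_le_mono:
  "sigma_box_dim_le d A \<Longrightarrow> d \<le> d' \<Longrightarrow> sigma_box_dim_le d' A"
  unfolding sigma_box_dim_le_def by (meson box_dim_le_mono)

lemma sigma_box_dim_le_UN:
  assumes "countable I" "\<And>i. i \<in> I \<Longrightarrow> sigma_box_dim_le d (A i)"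
  shows "sigma_box_dim_le d (\<Union>i\<in>I. A i)"
proof -
  obtain \<A> where \<A>: "\<And>i. i \<in> I \<Longrightarrow> countable (\<A> i) \<and> A i \<subseteq> \<Union>(\<A> i) \<and> (\<forall>X\<in>\<A> i. box_dim_le d X)"
    using assms(2) unfolding sigma_box_dim_le_def by metis
  show ?thesis
    unfolding sigma_box_dim_le_def
  proof (intro exI conjI)
    show "countable (\<Union>i\<in>I. \<A> i)"
      using \<A> by (intro countable_UN assms(1)) blast
    show "(\<Union>i\<in>I. A i) \<subseteq> \<Union>(\<Union>i\<in>I. \<A> i)"
    proof
      fix x assume "x \<in> (\<Union>i\<in>I. A i)"
      then obtain i where "i \<in> I" "x \<in> A i"
        by blast
      moreover from this have "x \<in> \<Union>(\<A> i)"
        using \<A>[of i] by blast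
      ultimately show "x \<in> \<Union>(\<Union>i\<in>I. \<A> i)"
        by blast
    qed
    show "\<forall>X\<in>(\<Union>i\<in>I. \<A> i). box_dim_le d X"
      using \<A> by simp
  qed
qed

lemma sigma_box_dim_le_compose:
  fixes A :: "('b::real_normed_vector \<Rightarrow>\<^sub>L 'c::real_normed_vector) set"
    and B :: "('a::real_normed_vector \<Rightarrow>\<^sub>L 'b) set"
  assumes "sigma_box_dim_le a A" "sigma_box_dim_le b B"
  shows "sigma_box_dim_le (a + b) {x o\<^sub>L y |x y. x \<in> A \<and> y \<in> B}"
proof -
  obtain \<A> \<B> where \<A>: "countable \<A>" "A \<subseteq> \<Union>\<A>" "\<And>X. X \<in> \<A> \<Longrightarrow> box_dim_le a X"
    and \<B>: "countable \<B>" "B \<subseteq> \<Union>\<B>" "\<And>X. X \<in> \<B> \<Longrightarrow> box_dim_le b X"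
    using assms unfolding sigma_box_dim_le_def by metis
  define \<C> where "\<C> = (\<lambda>(X, Y). {x o\<^sub>L y |x y. x \<in> X \<and> y \<in> Y}) ` (\<A> \<times> \<B>)"
  show ?thesis
    unfolding sigma_box_dim_le_def
  proof (intro exI conjI ballI)
    show "countable \<C>"
      unfolding \<C>_def using \<A>(1) \<B>(1) by auto
    show "{x o\<^sub>L y |x y. x \<in> A \<and> y \<in> B} \<subseteq> \<Union>\<C>"
    proof
      fix z assume "z \<in> {x o\<^sub>L y |x y. x \<in> A \<and> y \<in> B}"
      then obtain x y where z: "z = x o\<^sub>L y" "x \<in> A" "y \<in> B"
        by blast
      obtain X Y where XY: "X \<in> \<A>" "x \<in> X" "Y \<in> \<B>" "y \<in> Y"
        using z(2,3) \<A>(2) \<B>(2) by blast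
      have "{x o\<^sub>L y |x y. x \<in> X \<and> y \<in> Y} \<in> \<C>"
        unfolding \<C>_def using XY(1,3) by (intro image_eqI[of _ _ "(X, Y)"]) auto
      then show "z \<in> \<Union>\<C>"
        using z(1) XY(2,4) by blast
    qed
    fix Z assume "Z \<in> \<C>"
    then obtain X Y where "X \<in> \<A>" "Y \<in> \<B>" and Z: "Z = {x o\<^sub>L y |x y. x \<in> X \<and> y \<in> Y}"
      by (auto simp: \<C>_def)
    then show "box_dim_le (a + b) Z"
      unfolding Z using \<A>(3) \<B>(3) by (intro box_dim_le_compose)
  qed
qed

section \<open>Null sets and immersions\<close>

text \<open>
  By compactness of the unit sphere of the domain; the codomain may be any normed space, as is
  needed for spaces of operators.
\<close>

lemma linear_inj_bounded_below:
  fixes f :: "'a::euclidean_space \<Rightarrow> 'b::real_normed_vector"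
  assumes f: "linear f" "inj f"
  obtains B where "B > 0" "\<And>x. B * norm x \<le> norm (f x)"
proof -
  have cont: "continuous_on (sphere 0 1) (\<lambda>x. norm (f x))"
    using f(1) by (intro continuous_on_norm linear_continuous_on linear_conv_bounded_linear[THEN iffD1])
  obtain b :: 'a where "b \<in> Basis"
    using nonempty_Basis by blast
  then have "sphere (0::'a) 1 \<noteq> {}"
    by (auto intro!: exI[of _ b])
  then obtain x0 :: 'a where x0: "x0 \<in> sphere 0 1" "\<And>y. y \<in> sphere 0 1 \<Longrightarrow> norm (f x0) \<le> norm (f y)"
    using continuous_attains_inf[OF compact_sphere _ cont] by blast
  show thesis
  proof
    have "x0 \<noteq> 0"
      using x0(1) by auto
    then show "norm (f x0) > 0"
      using f linear_injective_0 by auto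
    fix x :: 'a
    show "norm (f x0) * norm x \<le> norm (f x)"
    proof (cases "x = 0")
      case False
      then have "norm (f x0) \<le> norm (f ((1 / norm x) *\<^sub>R x))"
        by (intro x0(2)) simp
      also have "\<dots> = norm (f x) / norm x"
        using f(1) by (simp add: linear_cmul)
      finally show ?thesis
        using False by (simp add: field_simps)
    qed simp
  qed
qed

text \<open>
  Near \<open>x0\<close> the derivative is close to its value at \<open>x0\<close>, so \<open>\<phi>\<close> differs from the linear map
  \<open>\<phi>'(x0)\<close> by a map with Lipschitz constant at most half of the lower bound of \<open>\<phi>'(x0)\<close>.
\<close>

lemma C1_immersion_locally_expanding:
  fixes \<phi> :: "'d::euclidean_space \<Rightarrow> 'b::real_normed_vector"
  assumes U: "open U" "x0 \<in> U" and C1: "Ck_on 1 U \<phi>"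
    and inj: "inj (frechet_derivative \<phi> (at x0))"
  obtains r B where "r > 0" "B > 0" "ball x0 r \<subseteq> U"
    "\<And>u v. u \<in> ball x0 r \<Longrightarrow> v \<in> ball x0 r \<Longrightarrow> B * dist u v \<le> dist (\<phi> u) (\<phi> v)"
proof -
  define D where "D u = frechet_derivative \<phi> (at u)" for u
  have der: "(\<phi> has_derivative D u) (at u)" if "u \<in> U" for u
    using C1 that by (simp add: D_def frechet_derivative_works)
  have lin: "linear (D u)" if "u \<in> U" for u
    using der[OF that] has_derivative_linear by blast
  have contD: "continuous_on U (\<lambda>u. D u v)" for v
    using C1 by (simp add: D_def)
  obtain B where B: "B > 0" "\<And>v. B * norm v \<le> norm (D x0 v)"
    using linear_inj_bounded_below[OF lin[OF U(2)]] inj D_def by metis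
  \<comment> \<open>tolerance for each partial derivative, so that the \<open>DIM('d)\<close> of them add up to \<open>B / 2\<close>\<close>
  define c where "c = B / (2 * real DIM('d))"
  have c: "c > 0"
    using B by (simp add: c_def)
  have "\<forall>\<^sub>F u in at x0. norm (D u b - D x0 b) < c" for b
  proof -
    have "isCont (\<lambda>u. D u b) x0"
      using contD U by (simp add: continuous_on_eq_continuous_at)
    then show ?thesis
      using c by (simp add: isCont_def tendsto_iff dist_norm)
  qed
  then have "\<forall>\<^sub>F u in at x0. \<forall>b\<in>Basis. norm (D u b - D x0 b) < c"
    by (simp add: eventually_ball_finite)
  then obtain r1 where r1: "r1 > 0"
    "\<And>u b. u \<noteq> x0 \<Longrightarrow> dist u x0 < r1 \<Longrightarrow> b \<in> Basis \<Longrightarrow> norm (D u b - D x0 b) < c"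
    unfolding eventually_at by auto
  obtain r2 where r2: "r2 > 0" "ball x0 r2 \<subseteq> U"
    using U openE by blast
  define r where "r = min r1 r2"
  have r: "r > 0" "ball x0 r \<subseteq> U"
    using r1 r2 by (auto simp: r_def)
  have close: "norm (D u b - D x0 b) \<le> c" if "u \<in> ball x0 r" "b \<in> Basis" for u b
    using r1(2)[of u b] that c by (cases "u = x0") (auto simp: r_def dist_commute less_imp_le)
  have small: "onorm (\<lambda>v. D u v - D x0 v) \<le> B / 2" if u: "u \<in> ball x0 r" for u
  proof (rule onorm_le)
    fix v :: 'd
    have l: "linear (\<lambda>v. D u v - D x0 v)"
      using lin u r U by (intro linear_compose_sub) auto
    have "norm (D u v - D x0 v) = norm (\<Sum>b\<in>Basis. (v \<bullet> b) *\<^sub>R (D u b - D x0 b))"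
      using linear_sum[OF l, of "\<lambda>b. (v \<bullet> b) *\<^sub>R b" Basis] linear_cmul[OF l]
      by (simp add: euclidean_representation)
    also have "\<dots> \<le> (\<Sum>b\<in>(Basis::'d set). norm v * c)"
    proof (rule sum_norm_le)
      fix b :: 'd assume b: "b \<in> Basis"
      show "norm ((v \<bullet> b) *\<^sub>R (D u b - D x0 b)) \<le> norm v * c"
        using close[OF u b] Basis_le_norm[OF b, of v] by (auto intro!: mult_mono)
    qed
    also have "\<dots> = B / 2 * norm v"
      by (simp add: c_def)
    finally show "norm (D u v - D x0 v) \<le> B / 2 * norm v" .
  qed
  show thesis
  proof
    show "r > 0" "B / 2 > 0" "ball x0 r \<subseteq> U"
      using r B by auto
    fix u v
    assume uv: "u \<in> ball x0 r" "v \<in> ball x0 r"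
    have "norm ((\<phi> u - D x0 u) - (\<phi> v - D x0 v)) \<le> B / 2 * norm (u - v)"
    proof (rule differentiable_bound[OF convex_ball _ small uv])
      fix x assume x: "x \<in> ball x0 r"
      show "((\<lambda>x. \<phi> x - D x0 x) has_derivative (\<lambda>v. D x v - D x0 v)) (at x within ball x0 r)"
        using x r U by (intro has_derivative_diff has_derivative_at_withinI[OF der]
            linear_imp_has_derivative lin) auto
    qed
    moreover have "B * norm (u - v) \<le> norm (D x0 u - D x0 v)"
      using B(2)[of "u - v"] lin[OF U(2)] by (simp add: linear_diff)
    moreover have "norm (D x0 u - D x0 v) \<le> norm (\<phi> u - \<phi> v) + norm ((\<phi> u - D x0 u) - (\<phi> v - D x0 v))"
      using norm_triangle_ineq4[of "\<phi> u - \<phi> v" "(\<phi> u - D x0 u) - (\<phi> v - D x0 v)"]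
      by (simp add: algebra_simps)
    ultimately show "B / 2 * dist u v \<le> dist (\<phi> u) (\<phi> v)"
      by (simp add: dist_norm)
  qed
qed

text \<open>
  Being negligible is a local property, and locally \<open>\<phi>\<close> is expanding, so that the box dimension
  of the preimage of \<open>A\<close> stays below the dimension of the domain.
\<close>

lemma negligible_immersion_vimage:
  fixes \<phi> :: "'d::euclidean_space \<Rightarrow> 'b::real_normed_vector"
  assumes U: "open U" and C1: "Ck_on 1 U \<phi>"
    and inj: "\<And>u. u \<in> U \<Longrightarrow> inj (frechet_derivative \<phi> (at u))"
    and A: "sigma_box_dim_le d A" and d: "d < DIM('d)"
  shows "negligible {u \<in> U. \<phi> u \<in> A}"
  unfolding locally_negligible_alt[of "{u \<in> U. \<phi> u \<in> A}"]
proof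
  fix x0 assume x0: "x0 \<in> {u \<in> U. \<phi> u \<in> A}"
  obtain \<A> where \<A>: "countable \<A>" "A \<subseteq> \<Union>\<A>" "\<And>X. X \<in> \<A> \<Longrightarrow> box_dim_le d X"
    using A unfolding sigma_box_dim_le_def by blast
  obtain r B where r: "r > 0" "B > 0" "ball x0 r \<subseteq> U"
    "\<And>u v. u \<in> ball x0 r \<Longrightarrow> v \<in> ball x0 r \<Longrightarrow> B * dist u v \<le> dist (\<phi> u) (\<phi> v)"
    using C1_immersion_locally_expanding[OF U _ C1 inj] x0 by blast
  have "negligible (\<Union>X\<in>\<A>. {u \<in> ball x0 r. \<phi> u \<in> X})"
    using \<A> d r
    by (intro negligible_countable_Union countable_image)
      (auto intro!: negligible_box_dim_le[OF _ d] box_dim_le_expanding_vimage[where B = B]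
        simp del: mem_ball)
  then have "negligible ({u \<in> U. \<phi> u \<in> A} \<inter> ball x0 r)"
    by (rule negligible_subset) (use \<A>(2) in blast)
  moreover have "openin (top_of_set {u \<in> U. \<phi> u \<in> A}) ({u \<in> U. \<phi> u \<in> A} \<inter> ball x0 r)"
    by (simp add: openin_open_Int)
  ultimately show "\<exists>V. openin (top_of_set {u \<in> U. \<phi> u \<in> A}) V \<and> x0 \<in> V \<and> negligible V"
    using x0 r(1) by (metis IntI centre_in_ball)
qed

section \<open>Subspaces as graphs over coordinates\<close>

text \<open>
  A subspace \<open>N\<close> has a complement spanned by coordinate vectors. If \<open>I\<close> is the set of the remaining
  coordinates, then projecting to \<open>span I\<close> along this complement is an isomorphism on \<open>N\<close>, that is,
  \<open>N\<close> is a graph over \<open>span I\<close>. The vectors \<open>s i\<close> are the points of the graph above the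
  coordinate vectors \<open>i \<in> I\<close>, and their coordinates outside \<open>I\<close> are the entries of its matrix.
\<close>

lemma subspace_graph_basis:
  fixes N :: "'a::euclidean_space set"
  assumes N: "subspace N"
  obtains I s where "I \<subseteq> Basis" "card I = dim N" "\<And>i. i \<in> I \<Longrightarrow> s i \<in> N"
    "\<And>i j. i \<in> I \<Longrightarrow> j \<in> I \<Longrightarrow> s i \<bullet> j = i \<bullet> j"
    "\<And>x. x \<in> N \<Longrightarrow> x = (\<Sum>i\<in>I. (x \<bullet> i) *\<^sub>R s i)"
proof -
  obtain B0 where B0: "B0 \<subseteq> N" "independent B0" "N \<subseteq> span B0" "card B0 = dim N"
    using basis_exists[of N] by blast
  have spB0: "span B0 = N"
    using B0 N by (metis span_minimal subset_antisym)
  obtain B where B: "B0 \<subseteq> B" "B \<subseteq> B0 \<union> Basis" "independent B" "B0 \<union> Basis \<subseteq> span B"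
    using maximal_independent_subset_extend[OF _ B0(2), of "B0 \<union> Basis"] by blast
  define J where "J = B - B0"
  define I where "I = Basis - J"
  have J: "J \<subseteq> Basis" "independent J"
    using B(2) independent_mono[OF B(3)] by (auto simp: J_def)
  have spB: "span B = UNIV"
    using B(4) by (metis Un_subset_iff span_Basis span_mono span_span top.extremum_uniqueI)
  have BJ: "B = B0 \<union> J"
    using B(1) by (auto simp: J_def)
  have cardB: "card B = DIM('a)"
    using B(3) spB by (metis dim_UNIV dim_span_eq_card_independent)
  have cardJ: "card J = DIM('a) - dim N"
    unfolding J_def using B B0(2,4) cardB by (simp add: card_Diff_subset independent_imp_finite)
  have le: "dim N \<le> DIM('a)"
    by (rule dim_subset_UNIV)
  have sums: "{x + y |x y. x \<in> N \<and> y \<in> span J} = UNIV"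
    using spB span_Un[of B0 J] by (simp add: BJ spB0)
  \<comment> \<open>\<open>N\<close> and \<open>span J\<close> span everything and their dimensions add up to \<open>DIM('a)\<close>, so they are independent\<close>
  have "dim (N \<inter> span J) = 0"
    using dim_sums_Int[OF N subspace_span[of J]] sums cardJ le J(2)
    by (simp add: dim_eq_card_independent)
  then have disj: "N \<inter> span J \<subseteq> {0}"
    by simp
  have orth: "b \<bullet> j = 0" if "b \<in> span J" "j \<in> I" for b j
  proof -
    have "span J \<subseteq> {x. j \<bullet> x = 0}"
      using that(2) J(1) by (intro span_minimal subspace_hyperplane) (auto simp: I_def inner_Basis)
    then show ?thesis
      using that(1) by (auto simp: inner_commute)
  qed
  have "\<exists>a\<in>N. \<exists>b\<in>span J. i = a + b" for i
    using sums by blast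
  then obtain s b where s: "\<And>i. s i \<in> N" "\<And>i. b i \<in> span J" "\<And>i. i = s i + b i"
    by metis
  have sI: "s i \<bullet> j = i \<bullet> j" if "j \<in> I" for i j
    using arg_cong[OF s(3)[of i], of "\<lambda>z. z \<bullet> j"] orth[OF s(2) that] by (simp add: inner_add_left)
  show thesis
  proof
    show I: "I \<subseteq> Basis"
      by (auto simp: I_def)
    have "card I = DIM('a) - card J"
      unfolding I_def using J by (simp add: card_Diff_subset independent_imp_finite)
    then show "card I = dim N"
      using cardJ le by simp
    show "s i \<in> N" for i
      by (rule s)
    show "s i \<bullet> j = i \<bullet> j" if "j \<in> I" for i j
      by (rule sI[OF that])
    fix x assume x: "x \<in> N"
    define y where "y = x - (\<Sum>i\<in>I. (x \<bullet> i) *\<^sub>R s i)"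
    have finI: "finite I"
      by (simp add: I_def)
    have "y \<in> N"
      unfolding y_def using N x s(1) by (intro subspace_diff subspace_sum subspace_mul)
    moreover have yI: "y \<bullet> j = 0" if "j \<in> I" for j
    proof -
      have "(\<Sum>i\<in>I. (x \<bullet> i) * (s i \<bullet> j)) = (\<Sum>i\<in>I. if i = j then x \<bullet> j else 0)"
      proof (rule sum.cong[OF refl])
        fix i assume "i \<in> I"
        then have "i \<in> Basis" "j \<in> Basis"
          using that by (auto simp: I_def)
        then show "(x \<bullet> i) * (s i \<bullet> j) = (if i = j then x \<bullet> j else 0)"
          using sI[OF that, of i] by (simp add: inner_Basis)
      qed
      then show ?thesis
        using that finI by (simp add: y_def inner_diff_left inner_sum_left)
    qed
    have "y \<in> span J"
    proof -
      have "y = (\<Sum>j\<in>Basis. (y \<bullet> j) *\<^sub>R j)"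
        by (simp add: euclidean_representation)
      also have "\<dots> \<in> span J"
      proof (rule span_sum)
        fix j :: 'a assume "j \<in> Basis"
        then show "(y \<bullet> j) *\<^sub>R j \<in> span J"
          using yI[of j] by (cases "j \<in> J") (auto simp: I_def span_zero intro: span_base span_scale)
      qed
      finally show ?thesis .
    qed
    ultimately have "y = 0"
      using disj by blast
    then show "x = (\<Sum>i\<in>I. (x \<bullet> i) *\<^sub>R s i)"
      by (simp add: y_def)
  qed
qed

section \<open>Lorentz involutions and their negative eigenspaces\<close>

lemma lor_add_left: "lor (x + y) z = lor x z + lor y z"
  and lor_add_right: "lor z (x + y) = lor z x + lor z y"
  and lor_diff_left: "lor (x - y) z = lor x z - lor y z"
  and lor_diff_right: "lor z (x - y) = lor z x - lor z y"
  by (simp_all add: lor_def algebra_simps)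

text \<open>
  The operator that turns the Lorentz form into the Euclidean inner product, used to compare
  adjoints for the two forms.
\<close>

definition time_reflection :: "('n::finite) mink \<Rightarrow> 'n mink" where
  "time_reflection x = (fst x, - snd x)"

lemma norm_time_reflection: "norm (time_reflection x) = norm x"
  by (simp add: time_reflection_def norm_prod_def)

lemma lor_time_reflection: "lor x (time_reflection y) = x \<bullet> y"
  by (simp add: lor_def time_reflection_def inner_prod_def)

lemma abs_lor_le: "\<bar>lor x y\<bar> \<le> norm x * norm y"
  using Cauchy_Schwarz_ineq2[of x "time_reflection y"]
  by (simp add: norm_time_reflection lor_time_reflection[symmetric])
     (simp add: time_reflection_def)

text \<open>
  The Lorentz adjoint is the Euclidean adjoint conjugated by an isometry, so it has the
  same operator norm.
\<close>

lemma norm_lor_adjoint_le: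
  fixes E F :: "('n::finite) mink \<Rightarrow> 'n mink"
  assumes adj: "\<And>x y. lor (E x) y = lor x (F y)"
    and F: "\<And>y. norm (F y) \<le> c * norm y"
  shows "norm (E x) \<le> c * norm x"
proof (cases "E x = 0")
  case True
  have "0 \<le> c * norm x"
    using order_trans[OF norm_ge_zero F[of x]] .
  then show ?thesis
    using True by simp
next
  case False
  define y where "y = time_reflection (E x)"
  have "norm (E x) * norm (E x) = lor (E x) y"
    by (simp add: y_def lor_time_reflection flip: power2_eq_square power2_norm_eq_inner)
  also have "\<dots> = lor x (F y)"
    by (rule adj)
  also have "\<dots> \<le> norm x * norm (F y)"
    using abs_lor_le[of x "F y"] by linarith
  also have "\<dots> \<le> norm x * (c * norm (E x))"
    using F[of y] by (intro mult_left_mono) (auto simp: y_def norm_time_reflection)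
  finally show ?thesis
    using False by (simp add: mult_ac)
qed

text \<open>
  The \<open>-1\<close>-eigenspace of \<open>L\<close> is the graph over the coordinates in \<open>I\<close> that lies above each
  \<open>i \<in> I\<close> at \<open>s i\<close>.
\<close>

definition eigen_graph ::
    "('a::euclidean_space \<Rightarrow>\<^sub>L 'a) \<Rightarrow> 'a set \<Rightarrow> ('a \<Rightarrow> 'a) \<Rightarrow> bool" where
  "eigen_graph L I s \<longleftrightarrow> I \<subseteq> Basis \<and> (\<forall>i\<in>I. L (s i) = - s i \<and> (\<forall>j\<in>I. s i \<bullet> j = i \<bullet> j))
     \<and> (\<forall>x. L x = - x \<longrightarrow> x = (\<Sum>i\<in>I. (x \<bullet> i) *\<^sub>R s i))"

text \<open>
  The vector \<open>u = x - L' x\<close> lies in the \<open>-1\<close>-space of \<open>L'\<close>. The point \<open>v\<close> of the \<open>-1\<close>-space of \<open>L\<close> with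
  the same coordinates in \<open>I\<close> is close to it, because the two graphs are close, and \<open>1 + L\<close>
  kills \<open>v\<close>.
\<close>

lemma eigen_graph_transversal_bound:
  fixes L L' :: "'a::euclidean_space \<Rightarrow>\<^sub>L 'a"
  assumes inv': "\<And>x. L' (L' x) = x"
    and R: "norm L \<le> R" "norm L' \<le> R"
    and s: "eigen_graph L I s" and s': "eigen_graph L' I s'"
    and t: "0 \<le> t" "\<And>i q. i \<in> I \<Longrightarrow> q \<in> Basis - I \<Longrightarrow> \<bar>s i \<bullet> q - s' i \<bullet> q\<bar> \<le> t"
  shows "norm ((x - L' x) + L (x - L' x)) \<le> ((1 + R)\<^sup>2 * (real DIM('a))\<^sup>2 * t) * norm x"
proof -
  define D where "D = real DIM('a)"
  define u where "u = x - L' x"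
  define v where "v = (\<Sum>i\<in>I. (u \<bullet> i) *\<^sub>R s i)"
  have R0: "0 \<le> R"
    using R(1) norm_ge_zero order_trans by blast
  have I: "I \<subseteq> Basis"
    using s by (simp add: eigen_graph_def)
  have "L' u = - u"
    by (simp add: u_def blinfun.diff_right inv')
  then have u: "u = (\<Sum>i\<in>I. (u \<bullet> i) *\<^sub>R s' i)"
    using s' unfolding eigen_graph_def by blast
  have Lv: "L v = - v"
    using s by (simp add: v_def blinfun.sum_right blinfun.scaleR_right eigen_graph_def sum_negf)
  have ss: "norm (s' i - s i) \<le> D * t" if i: "i \<in> I" for i
  proof -
    have "\<bar>(s' i - s i) \<bullet> q\<bar> \<le> t" if "q \<in> Basis" for q
    proof (cases "q \<in> I")
      case True
      then show ?thesis
        using s s' i t(1) by (simp add: eigen_graph_def inner_diff_left)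
    next
      case False
      then show ?thesis
        using t(2)[of i q] i that by (simp add: inner_diff_left abs_minus_commute)
    qed
    then have "(\<Sum>q\<in>Basis. \<bar>(s' i - s i) \<bullet> q\<bar>) \<le> (\<Sum>q\<in>(Basis::'a set). t)"
      by (rule sum_mono)
    then show ?thesis
      using norm_le_l1[of "s' i - s i"] by (simp add: D_def)
  qed
  have "u - v = (\<Sum>i\<in>I. (u \<bullet> i) *\<^sub>R (s' i - s i))"
    using u by (simp add: v_def scaleR_diff_right sum_subtractf)
  also have "norm \<dots> \<le> (\<Sum>i\<in>I. norm u * (D * t))"
  proof (rule sum_norm_le)
    fix i assume i: "i \<in> I"
    then have "\<bar>u \<bullet> i\<bar> \<le> norm u"
      using I Basis_le_norm by blast
    then show "norm ((u \<bullet> i) *\<^sub>R (s' i - s i)) \<le> norm u * (D * t)"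
      using ss[OF i] by (simp add: mult_mono)
  qed
  also have "\<dots> = real (card I) * (norm u * (D * t))"
    by simp
  also have "\<dots> \<le> D * (norm u * (D * t))"
    using card_mono[OF finite_Basis I] t(1) by (intro mult_right_mono) (auto simp: D_def)
  finally have uv: "norm (u - v) \<le> D * (norm u * (D * t))" .
  have apply_le: "norm (w + K w) \<le> (1 + R) * norm w" "norm (w - K w) \<le> (1 + R) * norm w"
    if "norm K \<le> R" for K :: "'a \<Rightarrow>\<^sub>L 'a" and w
  proof -
    have "norm (K w) \<le> R * norm w"
      using norm_blinfun[of K w] mult_right_mono[OF that norm_ge_zero] by (meson order_trans)
    then show "norm (w + K w) \<le> (1 + R) * norm w" "norm (w - K w) \<le> (1 + R) * norm w"
      using norm_triangle_ineq[of w "K w"] norm_triangle_ineq4[of w "K w"]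
      by (auto simp: algebra_simps)
  qed
  have "u + L u = (u - v) + L (u - v)"
    by (simp add: blinfun.diff_right Lv)
  then have "norm (u + L u) \<le> (1 + R) * norm (u - v)"
    using apply_le(1)[OF R(1), of "u - v"] by (simp only:)
  also have "\<dots> \<le> (1 + R) * (D * (norm u * (D * t)))"
    using uv R0 by (intro mult_left_mono) auto
  also have "\<dots> \<le> (1 + R) * (D * (((1 + R) * norm x) * (D * t)))"
    using apply_le(2)[OF R(2), of x] R0 t(1)
    by (intro mult_left_mono mult_right_mono) (auto simp: u_def D_def)
  also have "\<dots> = ((1 + R)\<^sup>2 * D\<^sup>2 * t) * norm x"
    by (simp add: power2_eq_square)
  finally show ?thesis
    by (simp add: u_def D_def)
qed

lemma lor_involution_self_adjoint:
  assumes "\<And>x. L (L x) = x" "\<And>x y. lor (L x) (L y) = lor x y"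
  shows "lor (L x) y = lor x (L y)"
  using assms by metis

text \<open>
  A Lorentz involution depends in a Lipschitz way on the matrix of the graph that is its
  \<open>-1\<close>-eigenspace, with a constant that depends only on a bound for the norms.
\<close>

lemma lor_involution_distance:
  fixes L L' :: "('n::finite) mink \<Rightarrow>\<^sub>L 'n mink"
  assumes inv: "\<And>x. L (L x) = x" "\<And>x. L' (L' x) = x"
    and iso: "\<And>x y. lor (L x) (L y) = lor x y" "\<And>x y. lor (L' x) (L' y) = lor x y"
    and R: "norm L \<le> R" "norm L' \<le> R"
    and s: "eigen_graph L I s" and s': "eigen_graph L' I s'"
    and t: "0 \<le> t" "\<And>i q. i \<in> I \<Longrightarrow> q \<in> Basis - I \<Longrightarrow> \<bar>s i \<bullet> q - s' i \<bullet> q\<bar> \<le> t"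
  shows "norm (L - L') \<le> (1 + R)\<^sup>2 * (real DIM('n mink))\<^sup>2 * t"
proof (rule norm_blinfun_bound)
  define c where "c = (1 + R)\<^sup>2 * (real DIM('n mink))\<^sup>2 * t"
  show "0 \<le> (1 + R)\<^sup>2 * (real DIM('n mink))\<^sup>2 * t"
    using t(1) by simp
  note adj = lor_involution_self_adjoint[of L, OF inv(1) iso(1)]
    lor_involution_self_adjoint[of L', OF inv(2) iso(2)]
  fix x
  have 1: "norm ((x - L' x) + L (x - L' x)) \<le> c * norm x"
    unfolding c_def by (rule eigen_graph_transversal_bound[OF inv(2) R s s' t])
  have "norm ((y - L y) + L' (y - L y)) \<le> c * norm y" for y
    unfolding c_def
    by (rule eigen_graph_transversal_bound[OF inv(1) R(2,1) s' s t(1)])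
      (use t(2) in \<open>simp add: abs_minus_commute\<close>)
  then have 2: "norm ((x + L' x) - L (x + L' x)) \<le> c * norm x"
    by (rule norm_lor_adjoint_le[rotated])
      (simp add: lor_add_left lor_add_right lor_diff_left lor_diff_right adj
        blinfun.add_right blinfun.diff_right)
  \<comment> \<open>the identity \<open>2 (L - L') = (1 + L) (1 - L') - (1 - L) (1 + L')\<close>, applied to \<open>x\<close>\<close>
  have "2 *\<^sub>R (L - L') x
      = ((x - L' x) + L (x - L' x)) - ((x + L' x) - L (x + L' x))"
    by (simp add: blinfun.diff_left blinfun.add_right blinfun.diff_right scaleR_2)
  then have "2 * norm ((L - L') x) \<le> c * norm x + c * norm x"
    using norm_triangle_le_diff[OF add_mono[OF 1 2]] by (metis abs_numeral norm_scaleR)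
  then show "norm ((L - L') x) \<le> ((1 + R)\<^sup>2 * (real DIM('n mink))\<^sup>2 * t) * norm x"
    unfolding c_def by linarith
qed

lemma ex_eigen_graph:
  fixes L :: "'a::euclidean_space \<Rightarrow>\<^sub>L 'a"
  obtains I s where "eigen_graph L I s" "card I = dim {x. L x = - x}"
proof -
  have "subspace {x. L x = - x}"
    by (auto simp: subspace_def blinfun.add_right blinfun.scaleR_right)
  then obtain I s where "I \<subseteq> Basis" "card I = dim {x. L x = - x}"
    "\<And>i. i \<in> I \<Longrightarrow> s i \<in> {x. L x = - x}"
    "\<And>i j. i \<in> I \<Longrightarrow> j \<in> I \<Longrightarrow> s i \<bullet> j = i \<bullet> j"
    "\<And>x. x \<in> {x. L x = - x} \<Longrightarrow> x = (\<Sum>i\<in>I. (x \<bullet> i) *\<^sub>R s i)"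
    using subspace_graph_basis by blast
  then have "eigen_graph L I s" "card I = dim {x. L x = - x}"
    by (auto simp: eigen_graph_def)
  then show thesis
    by (rule that)
qed

section \<open>Hyperbolic involutions as linear maps\<close>

lemma blinfun_eq_on_hyp:
  fixes L L' :: "('n::finite) mink \<Rightarrow>\<^sub>L 'n mink"
  assumes "\<And>p. p \<in> hyp \<Longrightarrow> L p = L' p"
  shows "L = L'"
proof (rule blinfun_eqI)
  show "L x = L' x" for x
    by (rule linear_eq_on_span[of "blinfun_apply L" "blinfun_apply L'" hyp])
      (auto simp: span_hyp blinfun.bounded_linear_right bounded_linear.linear intro: assms)
qed

lemma linear_rep_Mob_lor:
  fixes L :: "('n::finite) mink \<Rightarrow>\<^sub>L 'n mink"
  assumes L: "L \<in> linear_rep Mob"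
  shows "lor (L x) (L y) = lor x y"
proof -
  have lin: "linear (blinfun_apply L)"
    by (simp add: blinfun.bounded_linear_right bounded_linear.linear)
  have "bilinear (\<lambda>x y. lor (L x) (L y))"
    unfolding bilinear_def
  proof (intro conjI allI)
    fix x
    show "linear (\<lambda>y. lor (L x) (L y))"
      using linear_compose[OF lin, of "lor (L x)"] bilinear_lor
      unfolding bilinear_def o_def by blast
    show "linear (\<lambda>y. lor (L y) (L x))"
      using linear_compose[OF lin, of "\<lambda>y. lor y (L x)"] bilinear_lor
      unfolding bilinear_def o_def by blast
  qed
  then show ?thesis
  proof (rule bilinear_eq[OF _ bilinear_lor, of _ UNIV hyp UNIV hyp])
    fix p q :: "'n mink" assume "p \<in> hyp" "q \<in> hyp"
    then show "lor (L p) (L q) = lor p q"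
      using L Mob_lor[of "restrict (blinfun_apply L) hyp" p q] by (simp add: linear_rep_def)
  qed (auto simp: span_hyp)
qed

text \<open>
  The timelike vectors are open, so from a point \<open>p\<close> of \<open>hyp \<inter> W\<close> one can move a little in any
  direction \<open>w \<in> W\<close> and rescale to a point of \<open>hyp \<inter> W\<close> again. Hence \<open>hyp \<inter> W\<close>, if nonempty, spans
  \<open>W\<close>. This recovers the linear subspace from the totally geodesic subspace that it cuts out.
\<close>

lemma subspace_subset_if_hyp_Int_subset:
  fixes V W :: "('n::finite) mink set"
  assumes W: "subspace W" and V: "subspace V"
    and p: "p \<in> hyp \<inter> W" and sub: "hyp \<inter> W \<subseteq> V"
  shows "W \<subseteq> V"
proof
  fix w assume w: "w \<in> W"
  define f where "f t = lor (p + t *\<^sub>R w) (p + t *\<^sub>R w)" for t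
  have f: "f = (\<lambda>t. lor p p + 2 * t * lor p w + t\<^sup>2 * lor w w)"
    by (rule ext) (simp add: f_def lor_def algebra_simps power2_eq_square inner_commute)
  have "(f \<longlongrightarrow> f 0) (at 0)"
    unfolding f by (intro tendsto_intros)
  moreover have "f 0 < 0"
    using p by (simp add: f hyp_def)
  ultimately have "\<forall>\<^sub>F t in at 0. f t < 0"
    by (rule order_tendstoD)
  moreover have "((\<lambda>t. snd (p + t *\<^sub>R w)) \<longlongrightarrow> snd (p + 0 *\<^sub>R w)) (at 0)"
    by (intro tendsto_intros)
  then have "\<forall>\<^sub>F t in at 0. 0 < snd (p + t *\<^sub>R w)"
    by (rule order_tendstoD) (use p in \<open>simp add: hyp_def\<close>)
  moreover have "\<forall>\<^sub>F t::real in at 0. t \<noteq> 0"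
    by (simp add: eventually_at_filter)
  ultimately have "\<forall>\<^sub>F t in at 0. f t < 0 \<and> 0 < snd (p + t *\<^sub>R w) \<and> t \<noteq> 0"
    by (intro eventually_conj)
  then obtain t where t: "f t < 0" "0 < snd (p + t *\<^sub>R w)" "t \<noteq> 0"
    using eventually_happens[of _ "at (0::real)"] by (auto simp: trivial_limit_at)
  define c where "c = 1 / sqrt (- f t)"
  have c: "c > 0" "c\<^sup>2 * f t = - 1"
    using t(1) by (auto simp: c_def power_divide)
  have "lor (c *\<^sub>R (p + t *\<^sub>R w)) (c *\<^sub>R (p + t *\<^sub>R w)) = c\<^sup>2 * f t"
    by (simp add: f_def lor_def power2_eq_square algebra_simps)
  then have "c *\<^sub>R (p + t *\<^sub>R w) \<in> hyp"
    using c t(2) by (simp add: hyp_def)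
  moreover have "c *\<^sub>R (p + t *\<^sub>R w) \<in> W"
    using W p w by (intro subspace_mul subspace_add) auto
  ultimately have "c *\<^sub>R (p + t *\<^sub>R w) \<in> V"
    using sub by blast
  then have "(1 / c) *\<^sub>R c *\<^sub>R (p + t *\<^sub>R w) \<in> V"
    by (rule subspace_mul[OF V])
  moreover have "(1 / c) *\<^sub>R c *\<^sub>R (p + t *\<^sub>R w) = p + t *\<^sub>R w"
    unfolding scaleR_scaleR using c(1) by simp
  ultimately have "p + t *\<^sub>R w \<in> V"
    by (simp only:)
  then have "(p + t *\<^sub>R w) - p \<in> V"
    using p sub by (intro subspace_diff V) auto
  then have "(1 / t) *\<^sub>R ((p + t *\<^sub>R w) - p) \<in> V"
    by (intro subspace_mul V)
  then show "w \<in> V"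
    using t(3) by simp
qed

text \<open>
  The identity \<open>x = (x + L x) / 2 + (x - L x) / 2\<close> decomposes the space into the two
  eigenspaces.
\<close>

lemma dim_eigenspaces_of_involution:
  fixes L :: "'a::euclidean_space \<Rightarrow>\<^sub>L 'a"
  assumes inv: "\<And>x. L (L x) = x"
  shows "dim {x. L x = x} + dim {x. L x = - x} = DIM('a)"
proof -
  let ?P = "{x. L x = x}" and ?N = "{x. L x = - x}"
  have P: "subspace ?P" and N: "subspace ?N"
    by (auto simp: subspace_def blinfun.add_right blinfun.scaleR_right)
  have "x \<in> {x + y |x y. x \<in> ?P \<and> y \<in> ?N}" for x
  proof -
    have "x = (1/2) *\<^sub>R (x + L x) + (1/2) *\<^sub>R (x - L x)"
      by (simp add: algebra_simps flip: scaleR_add_left)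
    moreover have "(1/2) *\<^sub>R (x + L x) \<in> ?P" "(1/2) *\<^sub>R (x - L x) \<in> ?N"
      by (simp_all add: blinfun.add_right blinfun.diff_right blinfun.scaleR_right inv algebra_simps)
    ultimately show ?thesis
      by blast
  qed
  then have sums: "{x + y |x y. x \<in> ?P \<and> y \<in> ?N} = UNIV"
    by blast
  have "x = 0" if "L x = x" "L x = - x" for x
  proof -
    have "2 *\<^sub>R x = x + x"
      by (rule scaleR_2)
    also have "\<dots> = 0"
      using that by (metis add.right_inverse)
    finally show ?thesis
      by simp
  qed
  then have "?P \<inter> ?N = {0}"
    by (auto simp: blinfun.zero_right)
  then show ?thesis
    using dim_sums_Int[OF P N] sums by simp
qed

text \<open>
  The fixed points of the isometry are the points of \<open>hyp\<close> in the \<open>1\<close>-eigenspace of \<open>L\<close>, and also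
  those in the subspace \<open>W\<close> of dimension \<open>n - k + 1\<close> given by total geodesy. As there are fixed
  points, both subspaces are spanned by them and so agree.
\<close>

lemma linear_rep_involutions:
  fixes L :: "('n::finite) mink \<Rightarrow>\<^sub>L 'n mink"
  assumes L: "L \<in> linear_rep (involutions k)"
  shows "L (L x) = x" and "lor (L x) (L y) = lor x y" and "dim {x. L x = - x} = k"
proof -
  define g where "g = restrict (blinfun_apply L) hyp"
  have Lg: "L p = g p" if "p \<in> hyp" for p
    using that by (simp add: g_def)
  have g: "g \<in> Mob" "compose hyp g g = mob_one"
    and ex: "\<exists>m. m + k = CARD('n) \<and> totally_geodesic m (fixed_points g)"
    using L by (auto simp: linear_rep_def g_def involutions_def)
  show "lor (L x) (L y) = lor x y" for x y
    using g(1) by (intro linear_rep_Mob_lor) (simp add: linear_rep_def g_def)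
  have "L o\<^sub>L L = id_blinfun"
  proof (rule blinfun_eq_on_hyp)
    fix p :: "'n mink" assume p: "p \<in> hyp"
    then have gp: "g p \<in> hyp"
      using g(1) by (auto simp: Mob_def bij_betw_def)
    show "(L o\<^sub>L L) p = id_blinfun p"
      using fun_cong[OF g(2), of p] p by (simp add: Lg gp compose_eq mob_one_def)
  qed
  then show inv: "L (L x) = x" for x
    by (metis blinfun_apply_blinfun_compose blinfun_apply_id_blinfun id_apply)
  obtain m W where m: "m + k = CARD('n)" and W: "subspace W" "dim W = m + 1"
    "fixed_points g = hyp \<inter> W" "fixed_points g \<noteq> {}"
    using ex unfolding totally_geodesic_def by blast
  let ?P = "{x. L x = x}"
  have P: "subspace ?P"
    by (auto simp: subspace_def blinfun.add_right blinfun.scaleR_right)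
  have fixP: "fixed_points g = hyp \<inter> ?P"
    by (auto simp: fixed_points_def Lg)
  obtain p where p: "p \<in> fixed_points g"
    using W(4) by blast
  have "W \<subseteq> ?P"
    by (rule subspace_subset_if_hyp_Int_subset[OF W(1) P, of p]) (use p W(3) fixP in auto)
  moreover have "?P \<subseteq> W"
    by (rule subspace_subset_if_hyp_Int_subset[OF P W(1), of p]) (use p W(3) fixP in auto)
  ultimately have "W = ?P"
    by blast
  then show "dim {x. L x = - x} = k"
    using dim_eigenspaces_of_involution[of L, OF inv] W(2) m by simp
qed

section \<open>The dimension of the set of involutions\<close>

text \<open>
  Countably many of these bounded pieces exhaust the involutions of type \<open>k\<close>, and on each of them
  the coordinates \<open>I\<close> are fixed.
\<close>

definition bounded_graph_involutions ::
    "nat \<Rightarrow> ('n::finite) mink set \<Rightarrow> nat \<Rightarrow> ('n mink \<Rightarrow>\<^sub>L 'n mink) set" where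
  "bounded_graph_involutions k I r = {L \<in> linear_rep (involutions k). norm L \<le> real r
     \<and> (\<exists>s. eigen_graph L I s \<and> (\<forall>i\<in>I. norm (s i) \<le> real r))}"

text \<open>
  The coordinates are the entries \<open>s i \<bullet> q\<close>, \<open>i \<in> I\<close>, \<open>q \<in> Basis - I\<close>, of the matrix of the graph.
\<close>

lemma box_dim_bounded_graph_involutions:
  fixes I :: "('n::finite) mink set"
  assumes I: "I \<subseteq> Basis" and card: "card I = k"
  shows "box_dim_le (k * (CARD('n) + 1 - k)) (bounded_graph_involutions k I r)"
proof -
  let ?A = "bounded_graph_involutions k I r"
  have "\<forall>L\<in>?A. \<exists>s. eigen_graph L I s \<and> (\<forall>i\<in>I. norm (s i) \<le> real r)"
    by (auto simp: bounded_graph_involutions_def)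
  then obtain S where S: "\<And>L. L \<in> ?A \<Longrightarrow> eigen_graph L I (S L)"
    "\<And>L i. L \<in> ?A \<Longrightarrow> i \<in> I \<Longrightarrow> norm (S L i) \<le> real r"
    by metis
  have finI: "finite I"
    using I finite_Basis by (rule finite_subset)
  have rep: "L \<in> linear_rep (involutions k)" and nrm: "norm L \<le> real r" if "L \<in> ?A" for L
    using that by (auto simp: bounded_graph_involutions_def)
  have "box_dim_le (card (I \<times> (Basis - I))) ?A"
  proof (rule box_dim_le_coordinates[where f = "\<lambda>L (i, q). S L i \<bullet> q" and R = "real r"])
    show "finite (I \<times> (Basis - I))"
      using finI by simp
    show "bounded ?A"
      using nrm unfolding bounded_iff by blast
    show "\<bar>case iq of (i, q) \<Rightarrow> S L i \<bullet> q\<bar> \<le> real r" if "L \<in> ?A" "iq \<in> I \<times> (Basis - I)" for L iq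
    proof -
      obtain i q where iq: "iq = (i, q)"
        by (cases iq)
      have "\<bar>S L i \<bullet> q\<bar> \<le> norm (S L i)"
        using that(2) iq by (intro Basis_le_norm) simp
      also have "\<dots> \<le> real r"
        using that iq by (intro S(2)) auto
      finally show ?thesis
        by (simp add: iq)
    qed
    fix L L' t
    assume L: "L \<in> ?A" "L' \<in> ?A" and t: "0 \<le> t"
      "\<And>iq. iq \<in> I \<times> (Basis - I) \<Longrightarrow>
        \<bar>(case iq of (i, q) \<Rightarrow> S L i \<bullet> q) - (case iq of (i, q) \<Rightarrow> S L' i \<bullet> q)\<bar> \<le> t"
    have t': "\<bar>S L i \<bullet> q - S L' i \<bullet> q\<bar> \<le> t" if "i \<in> I" "q \<in> Basis - I" for i q
      using t(2)[of "(i, q)"] that by simp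
    note inv = linear_rep_involutions[OF rep]
    show "dist L L' \<le> ((1 + real r)\<^sup>2 * (real DIM('n mink))\<^sup>2) * t"
      unfolding dist_norm
      by (rule lor_involution_distance[OF inv(1)[OF L(1)] inv(1)[OF L(2)] inv(2)[OF L(1)]
            inv(2)[OF L(2)] nrm[OF L(1)] nrm[OF L(2)] S(1)[OF L(1)] S(1)[OF L(2)] t(1) t'])
  qed
  moreover have "card (I \<times> (Basis - I)) = k * (CARD('n) + 1 - k)"
    using card I finI by (simp add: card_cartesian_product card_Diff_subset)
  ultimately show ?thesis
    by simp
qed

lemma sigma_box_dim_involutions:
  "sigma_box_dim_le (k * (CARD('n) + 1 - k)) (linear_rep (involutions k :: ('n::finite) hypfun set))"
  unfolding sigma_box_dim_le_def
proof (intro exI conjI ballI)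
  let ?Is = "{I :: 'n mink set. I \<subseteq> Basis \<and> card I = k}"
  let ?\<A> = "(\<lambda>(I, r). bounded_graph_involutions k I r) ` (?Is \<times> UNIV)"
  have "finite ?Is"
    by (rule finite_subset[of _ "Pow Basis"]) auto
  then show "countable ?\<A>"
    by (intro countable_image countable_SIGMA) (auto intro: countable_finite)
  show "box_dim_le (k * (CARD('n) + 1 - k)) X" if "X \<in> ?\<A>" for X
    using that box_dim_bounded_graph_involutions by auto
  show "linear_rep (involutions k) \<subseteq> \<Union>?\<A>"
  proof
    fix L :: "'n mink \<Rightarrow>\<^sub>L 'n mink"
    assume L: "L \<in> linear_rep (involutions k)"
    obtain I s where s: "eigen_graph L I s" "card I = dim {x. L x = - x}"
      by (rule ex_eigen_graph)
    then have I: "I \<in> ?Is"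
      using linear_rep_involutions(3)[OF L] by (simp add: eigen_graph_def)
    then have finI: "finite I"
      by (intro finite_subset[OF _ finite_Basis]) simp
    obtain r :: nat where r: "norm L + (\<Sum>i\<in>I. norm (s i)) \<le> real r"
      using real_arch_simple by blast
    have "0 \<le> (\<Sum>i\<in>I. norm (s i))"
      by (simp add: sum_nonneg)
    then have "norm L \<le> real r"
      using r by linarith
    moreover have "norm (s i) \<le> real r" if "i \<in> I" for i
    proof -
      have "norm (s i) \<le> (\<Sum>i\<in>I. norm (s i))"
        by (rule member_le_sum[OF that norm_ge_zero finI])
      then show ?thesis
        using r norm_ge_zero[of L] by linarith
    qed
    ultimately have "L \<in> bounded_graph_involutions k I r"
      using L s(1) by (auto simp: bounded_graph_involutions_def)
    then show "L \<in> \<Union>?\<A>"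
      using I by blast
  qed
qed

section \<open>Products of involutions\<close>

lemma mob_one_in_Mob: "mob_one \<in> Mob"
  by (auto simp: Mob_def mob_one_def bij_betw_def inj_on_def)

lemma compose_in_Mob:
  assumes f: "f \<in> Mob" and g: "g \<in> Mob"
  shows "compose hyp f g \<in> Mob"
proof -
  have "g p \<in> hyp" if "p \<in> hyp" for p
    using g that by (auto simp: Mob_def bij_betw_def)
  then show ?thesis
    using f g by (auto simp: Mob_def compose_eq intro: bij_betw_compose)
qed

lemma mob_prod_in_Mob: "set \<alpha>s \<subseteq> Mob \<Longrightarrow> mob_prod \<alpha>s \<in> Mob"
  by (induction \<alpha>s) (auto simp: mob_prod_def mob_one_in_Mob compose_in_Mob)

text \<open>
  Passing to linear extensions is a homomorphism. By uniqueness of the extension, every linear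
  representative of a product is itself a product of representatives.
\<close>

lemma linear_rep_compose:
  fixes f g :: "('n::finite) hypfun"
  assumes f: "f \<in> Mob" and g: "g \<in> Mob" and L: "restrict (blinfun_apply L) hyp = compose hyp f g"
  obtains A B where "L = A o\<^sub>L B" "restrict (blinfun_apply A) hyp = f" "restrict (blinfun_apply B) hyp = g"
proof -
  obtain A where A: "restrict (blinfun_apply A) hyp = f"
    using Mob_linear_extension[OF f] by blast
  obtain B where B: "restrict (blinfun_apply B) hyp = g"
    using Mob_linear_extension[OF g] by blast
  have "L = A o\<^sub>L B"
  proof (rule blinfun_eq_on_hyp)
    fix p :: "'n mink" assume p: "p \<in> hyp"
    then have "g p \<in> hyp"
      using g by (auto simp: Mob_def bij_betw_def)
    then have "A (B p) = f (g p)"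
      using p fun_cong[OF A, of "g p"] fun_cong[OF B, of p] by simp
    moreover have "L p = f (g p)"
      using fun_cong[OF L, of p] p by (simp add: compose_eq)
    ultimately show "L p = (A o\<^sub>L B) p"
      by simp
  qed
  then show thesis
    using A B by (rule that)
qed

lemma sigma_box_dim_products:
  fixes S :: "('n::finite) hypfun set"
  assumes S: "S \<subseteq> Mob" and dim: "sigma_box_dim_le d (linear_rep S)"
  shows "sigma_box_dim_le (m * d) (linear_rep (mob_prod ` {\<alpha>s. set \<alpha>s \<subseteq> S \<and> length \<alpha>s = m}))"
proof (induction m)
  case 0
  have "linear_rep (mob_prod ` {\<alpha>s. set \<alpha>s \<subseteq> S \<and> length \<alpha>s = 0}) \<subseteq> {id_blinfun}"
  proof
    fix L :: "'n mink \<Rightarrow>\<^sub>L 'n mink"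
    assume "L \<in> linear_rep (mob_prod ` {\<alpha>s. set \<alpha>s \<subseteq> S \<and> length \<alpha>s = 0})"
    then have L: "restrict (blinfun_apply L) hyp = mob_one"
      by (auto simp: linear_rep_def mob_prod_def)
    have "L = id_blinfun"
    proof (rule blinfun_eq_on_hyp)
      fix p :: "'n mink" assume "p \<in> hyp"
      then show "L p = id_blinfun p"
        using fun_cong[OF L, of p] by (simp add: mob_one_def)
    qed
    then show "L \<in> {id_blinfun}"
      by simp
  qed
  moreover have "box_dim_le (card {}) {id_blinfun :: 'n mink \<Rightarrow>\<^sub>L 'n mink}"
    by (rule box_dim_le_coordinates[where K = 0 and R = 0 and f = "\<lambda>_ _. 0"]) auto
  ultimately show ?case
    unfolding sigma_box_dim_le_def by (intro exI[of _ "{{id_blinfun}}"]) simp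
next
  case (Suc m)
  let ?words = "\<lambda>m. mob_prod ` {\<alpha>s. set \<alpha>s \<subseteq> S \<and> length \<alpha>s = m}"
  have "linear_rep (?words (Suc m)) \<subseteq> {A o\<^sub>L B |A B. A \<in> linear_rep S \<and> B \<in> linear_rep (?words m)}"
  proof
    fix L assume "L \<in> linear_rep (?words (Suc m))"
    then obtain \<gamma>s where \<gamma>s: "set \<gamma>s \<subseteq> S" "length \<gamma>s = Suc m"
      "restrict (blinfun_apply L) hyp = mob_prod \<gamma>s"
      by (auto simp: linear_rep_def)
    then obtain \<alpha> \<beta>s where \<alpha>: "\<gamma>s = \<alpha> # \<beta>s"
      by (cases \<gamma>s) auto
    have mem: "\<alpha> \<in> S" "mob_prod \<beta>s \<in> ?words m"
      using \<gamma>s \<alpha> by auto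
    have L: "restrict (blinfun_apply L) hyp = compose hyp \<alpha> (mob_prod \<beta>s)"
      using \<gamma>s(3) by (simp add: \<alpha> mob_prod_def)
    have Mob: "\<alpha> \<in> Mob" "mob_prod \<beta>s \<in> Mob"
      using S \<gamma>s(1) \<alpha> by (auto intro!: mob_prod_in_Mob)
    obtain A B where AB: "L = A o\<^sub>L B"
      "restrict (blinfun_apply A) hyp = \<alpha>" "restrict (blinfun_apply B) hyp = mob_prod \<beta>s"
      by (rule linear_rep_compose[OF Mob L])
    have "A \<in> linear_rep S" "B \<in> linear_rep (?words m)"
      using mem AB(2,3) by (simp_all add: linear_rep_def)
    then show "L \<in> {A o\<^sub>L B |A B. A \<in> linear_rep S \<and> B \<in> linear_rep (?words m)}"
      using AB(1) by blast
  qed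
  moreover have "sigma_box_dim_le (Suc m * d)
      {A o\<^sub>L B |A B. A \<in> linear_rep S \<and> B \<in> linear_rep (?words m)}"
    using sigma_box_dim_le_compose[OF dim Suc.IH] by simp
  ultimately show ?case
    by (rule sigma_box_dim_le_subset[rotated])
qed

section \<open>Short products have measure zero\<close>

lemma linear_rep_UN: "linear_rep (\<Union>i\<in>I. A i) = (\<Union>i\<in>I. linear_rep (A i))"
  by (auto simp: linear_rep_def)

text \<open>
  A chart is in particular a \<open>C\<^sup>1\<close> immersion, so the preimage of the small set \<open>linear_rep A\<close>
  is null.
\<close>

lemma Mob_measure_zero_if_sigma_box_dim_le:
  fixes A :: "('n::finite) hypfun set"
  assumes A: "A \<subseteq> Mob" and dim: "sigma_box_dim_le e (linear_rep A)" "e < DIM('d::euclidean_space)"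
  shows "Mob_measure_zero TYPE('d) A"
  unfolding Mob_measure_zero_def measure_zero_in_def
proof (intro conjI allI impI)
  show "A \<subseteq> Mob"
    by (rule A)
  then show "linear_rep A \<subseteq> linear_rep Mob"
    by (auto simp: linear_rep_def)
  fix U :: "'d set" and \<phi> :: "'d \<Rightarrow> 'n mink \<Rightarrow>\<^sub>L 'n mink"
  assume chart: "smooth_chart U \<phi> (linear_rep Mob)"
  show "negligible {u \<in> U. \<phi> u \<in> linear_rep A}"
  proof (rule negligible_immersion_vimage[OF _ _ _ dim])
    show "open U" "Ck_on 1 U \<phi>"
      using chart unfolding smooth_chart_def smooth_on_def by blast+
    show "inj (frechet_derivative \<phi> (at u))" if "u \<in> U" for u
      using chart that unfolding smooth_chart_def by blast
  qed
qed

theorem theorem4p1: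
  fixes J :: "nat set" and S :: "('n::finite) hypfun set" and M :: nat
  assumes "CARD('n) \<ge> 2"
    and "DIM('d::euclidean_space) = CARD('n) * (CARD('n) + 1) div 2"
    and "J \<subseteq> {1..CARD('n) - 1}" and "J \<noteq> {}"
    and "S = (\<Union>k\<in>J. involutions k)"
    and "M = Max ((\<lambda>k. k * (CARD('n) - k + 1)) ` J)"
  shows "Mob_measure_zero TYPE('d)
           {g. \<exists>\<alpha>s. set \<alpha>s \<subseteq> S
                 \<and> real (length \<alpha>s) < real (CARD('n) * (CARD('n) + 1)) / (2 * real M)
                 \<and> g = mob_prod \<alpha>s}"
    (is "Mob_measure_zero _ ?A")
proof -
  let ?D = "CARD('n) * (CARD('n) + 1) div 2"
  define words where "words m = mob_prod ` {\<alpha>s. set \<alpha>s \<subseteq> S \<and> length \<alpha>s = m}" for m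
  have S: "S \<subseteq> Mob"
    by (auto simp: assms(5) involutions_def)
  have finJ: "finite J"
    using finite_subset[OF assms(3)] by simp
  have le_M: "k * (CARD('n) + 1 - k) \<le> M" if k: "k \<in> J" for k
  proof -
    have "k \<le> CARD('n) - 1"
      using subsetD[OF assms(3) k] by simp
    then have "CARD('n) + 1 - k = CARD('n) - k + 1"
      by linarith
    then show ?thesis
      unfolding assms(6) using k finJ by (intro Max_ge) auto
  qed
  obtain k where k: "k \<in> J"
    using assms(4) by blast
  then have "k \<in> {1..CARD('n) - 1}"
    using assms(3) by blast
  then have "0 < k * (CARD('n) + 1 - k)"
    by (simp add: nat_0_less_mult_iff) linarith
  then have M: "M > 0"
    using le_M[OF k] by linarith
  have dimS: "sigma_box_dim_le M (linear_rep S)"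
    unfolding assms(5) linear_rep_UN
    by (intro sigma_box_dim_le_UN sigma_box_dim_le_mono[OF sigma_box_dim_involutions le_M]
        countable_finite finJ)
  \<comment> \<open>strict inequality between integers: this leaves room for a dimension below that of the group\<close>
  have short: "m * M \<le> ?D - 1"
    if "real m < real (CARD('n) * (CARD('n) + 1)) / (2 * real M)" for m
  proof -
    have "real (2 * (m * M)) < real (CARD('n) * (CARD('n) + 1))"
      using that M by (simp add: field_simps)
    then have "2 * (m * M) < CARD('n) * (CARD('n) + 1)"
      by (simp only: of_nat_less_iff)
    moreover have "2 * ?D = CARD('n) * (CARD('n) + 1)"
      by (rule dvd_mult_div_cancel) simp
    ultimately show ?thesis
      by linarith
  qed
  have "?A \<subseteq> (\<Union>m\<in>{m. m * M \<le> ?D - 1}. words m)"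
  proof
    fix g assume "g \<in> ?A"
    then obtain \<alpha>s where \<alpha>s: "set \<alpha>s \<subseteq> S" "g = mob_prod \<alpha>s"
      "real (length \<alpha>s) < real (CARD('n) * (CARD('n) + 1)) / (2 * real M)"
      by blast
    then have "g \<in> words (length \<alpha>s)"
      by (simp add: words_def)
    then show "g \<in> (\<Union>m\<in>{m. m * M \<le> ?D - 1}. words m)"
      using short[OF \<alpha>s(3)] by blast
  qed
  then have "linear_rep ?A \<subseteq> (\<Union>m\<in>{m. m * M \<le> ?D - 1}. linear_rep (words m))"
    unfolding linear_rep_UN[symmetric] unfolding linear_rep_def by blast
  moreover have "sigma_box_dim_le (?D - 1) (\<Union>m\<in>{m. m * M \<le> ?D - 1}. linear_rep (words m))"
    unfolding words_def
    by (intro sigma_box_dim_le_UN sigma_box_dim_le_mono[OF sigma_box_dim_products[OF S dimS]]) simp_all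
  ultimately have "sigma_box_dim_le (?D - 1) (linear_rep ?A)"
    by (rule sigma_box_dim_le_subset[rotated])
  moreover have "?D - 1 < DIM('d)"
    using assms(2) DIM_positive[where 'a = 'd] by linarith
  moreover have "?A \<subseteq> Mob"
    using mob_prod_in_Mob order_trans[OF _ S] by blast
  ultimately show ?thesis
    by (intro Mob_measure_zero_if_sigma_box_dim_le)
qed

end
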